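(* Let $(X,\mathcal{B},\mu)$ be a Radon measure on a Hausdorff space $X$. Then there is a measure-preserving isomorphism of locales $$L(\mathcal{K}(X),\mu)\cong L(\mathcal{B}/\mathcal{N}),$$ where $\mathcal{K}(X)$ is the lower bounded distributive lattice of compact subsets of $X$ equipped with the restriction of $\mu$, $L(\mathcal{K}(X),\mu)$ carries its inner measure $\mu_*$, and $L(\mathcal{B}/\mathcal{N})$ is the locale associated to the measure algebra $\mathcal{B}/\mathcal{N}$ of $\mu$, i.e. the complete Boolean algebra of measurable sets modulo null sets, with the measure induced by $\mu$.
   Context: A frame is a poset with arbitrary suprema and finite infima satisfying $V\wedge\bigvee_i U_i=\bigvee_i(V\wedge U_i)$; locales are the objects of the opposite category of frames (frame homomorphisms preserve arbitrary suprema and finite infima), and $L(F)$ denotes the locale corresponding to the frame $F$. A complete Boolean algebra is a frame. A measure on a locale with frame $F$ is a monotone map $\nu:F\to[0,\infty]$ with $\nu(0)=0$, $\nu(U)+\nu(V)=\nu(U\vee V)+\nu(U\wedge V)$, and $\nu(\bigvee_iU_i)=\sup_i\nu(U_i)$ for directed families. A map of locales is measure-preserving if its frame homomorphism preserves the measures. A Radon measure on a Hausdorff space $X$ is a $\sigma$-algebra $\mathcal{B}$ on $X$ with a ($\sigma$-additive) measure $\mu$ on $\mathcal{B}$ such that: (i) $(X,\mathcal{B},\mu)$ is a complete measure space; (ii) $\mathcal{B}$ contains all open sets; (iii) if $E\subset X$ and $E\cap F\in\mathcal{B}$ for all $F\in\mathcal{B}$ with $\mu(F)<\infty$, then $E\in\mathcal{B}$;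 (iv) $\mu(E)=\sup\{\mu(C)\mid C\subset E,\ C\text{ compact}\}$ for every $E\in\mathcal{B}$; (v) every $x\in X$ has an open neighbourhood $U$ with $\mu(U)<\infty$. $\mathcal{N}\subset\mathcal{B}$ is the ideal of $\mu$-null sets. The restriction of $\mu$ to $\mathcal{K}(X)$ is a finite valuation (monotone, $\mu(\emptyset)=0$, $\mu(p)+\mu(q)=\mu(p\cup q)+\mu(p\cap q)$, finite values). For a lower bounded distributive lattice $D$ with finite valuation $\mu$, a family $\{p_i\le p\}_{i\in I}$ is a $\mu$-inner cover iff for all $\epsilon>0$ there is a finite $F\subset I$ with $\mu(p)-\mu(\bigvee_{i\in F}p_i)<\epsilon$. A $\mu$-ideal is a downward closed subset $U\subset D$ such that $p\in U$ whenever $p$ has a $\mu$-inner cover by elements of $U$. The $\mu$-ideals ordered by inclusion form a frame $\mathrm{Sh}(D,\mu;\mathbf 2)$; $L(D,\mu)$ is the corresponding locale, and its inner measure is $\mu_*(U)=\sup_{p\in U}\mu(p)$. *)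

theory Defs
  imports "HOL-Analysis.Analysis" "HOL-Algebra.Complete_Lattice"
begin

section \<open>Frames, locales and measures on them\<close>

locale frame = complete_lattice +
  assumes inf_Sup_distrib:
    "\<lbrakk>V \<in> carrier L; A \<subseteq> carrier L\<rbrakk> \<Longrightarrow> V \<sqinter> (\<Squnion>A) = \<Squnion>((\<lambda>U. V \<sqinter> U) ` A)"

locale complete_boolean_algebra = complete_lattice +
  assumes inf_sup_distrib:
    "\<lbrakk>x \<in> carrier L; y \<in> carrier L; z \<in> carrier L\<rbrakk> \<Longrightarrow> x \<sqinter> (y \<squnion> z) = (x \<sqinter> y) \<squnion> (x \<sqinter> z)"
    and complement_exists:
    "x \<in> carrier L \<Longrightarrow> \<exists>y\<in>carrier L. x \<sqinter> y = \<bottom> \<and> x \<squnion> y = \<top>"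

locale frame_hom = source: frame F + target: frame G
  for F :: "('a, 'c) gorder_scheme" (structure) and G :: "('b, 'd) gorder_scheme" (structure) +
  fixes h :: "'a \<Rightarrow> 'b"
  assumes hom_closed: "U \<in> carrier F \<Longrightarrow> h U \<in> carrier G"
    and hom_Sup: "A \<subseteq> carrier F \<Longrightarrow> h (\<Squnion>\<^bsub>F\<^esub>A) = \<Squnion>\<^bsub>G\<^esub>(h ` A)"
    and hom_top: "h \<top>\<^bsub>F\<^esub> = \<top>\<^bsub>G\<^esub>"
    and hom_inf: "\<lbrakk>U \<in> carrier F; V \<in> carrier F\<rbrakk> \<Longrightarrow> h (U \<sqinter>\<^bsub>F\<^esub> V) = h U \<sqinter>\<^bsub>G\<^esub> h V"

text \<open>The locale \<open>L(F)\<close> is represented by its frame \<open>F\<close>; only the direction of maps changes.\<close>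

definition locale_map ::
  "('a, 'c) gorder_scheme \<Rightarrow> ('b, 'd) gorder_scheme \<Rightarrow> ('b \<Rightarrow> 'a) \<Rightarrow> bool" where
  "locale_map F G h \<longleftrightarrow> frame_hom G F h"

definition directed_subset :: "('a, 'c) gorder_scheme \<Rightarrow> 'a set \<Rightarrow> bool" where
  "directed_subset L A \<longleftrightarrow> A \<subseteq> carrier L \<and> A \<noteq> {} \<and> (\<forall>x\<in>A. \<forall>y\<in>A. \<exists>z\<in>A. x \<sqsubseteq>\<^bsub>L\<^esub> z \<and> y \<sqsubseteq>\<^bsub>L\<^esub> z)"

locale measured_frame = frame +
  fixes \<nu> :: "'a \<Rightarrow> ennreal"
  assumes measure_mono: "\<lbrakk>U \<in> carrier L; V \<in> carrier L; U \<sqsubseteq> V\<rbrakk> \<Longrightarrow> \<nu> U \<le> \<nu> V"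
    and measure_bottom: "\<nu> \<bottom> = 0"
    and measure_modular:
    "\<lbrakk>U \<in> carrier L; V \<in> carrier L\<rbrakk> \<Longrightarrow> \<nu> U + \<nu> V = \<nu> (U \<squnion> V) + \<nu> (U \<sqinter> V)"
    and measure_directed_Sup: "directed_subset L A \<Longrightarrow> \<nu> (\<Squnion>A) = (SUP U\<in>A. \<nu> U)"

definition measure_preserving_locale_map ::
  "('a, 'c) gorder_scheme \<Rightarrow> ('a \<Rightarrow> ennreal) \<Rightarrow> ('b, 'd) gorder_scheme \<Rightarrow> ('b \<Rightarrow> ennreal)
    \<Rightarrow> ('b \<Rightarrow> 'a) \<Rightarrow> bool" where
  "measure_preserving_locale_map F \<nu> G \<nu>' h \<longleftrightarrow>
    measured_frame F \<nu> \<and> measured_frame G \<nu>' \<and> locale_map F G h \<and>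
    (\<forall>V\<in>carrier G. \<nu> (h V) = \<nu>' V)"

definition measure_preserving_locale_iso ::
  "('a, 'c) gorder_scheme \<Rightarrow> ('a \<Rightarrow> ennreal) \<Rightarrow> ('b, 'd) gorder_scheme \<Rightarrow> ('b \<Rightarrow> ennreal)
    \<Rightarrow> bool" where
  "measure_preserving_locale_iso F \<nu> G \<nu>' \<longleftrightarrow>
    (\<exists>f g. measure_preserving_locale_map F \<nu> G \<nu>' f \<and> measure_preserving_locale_map G \<nu>' F \<nu> g \<and>
       (\<forall>V\<in>carrier G. g (f V) = V) \<and> (\<forall>U\<in>carrier F. f (g U) = U))"


section \<open>The locale of a finite valuation\<close>

locale lower_bounded_distributive_lattice = lattice + weak_partial_order_bottom +
  assumes inf_sup_distrib:
    "\<lbrakk>x \<in> carrier L; y \<in> carrier L; z \<in> carrier L\<rbrakk> \<Longrightarrow> x \<sqinter> (y \<squnion> z) = (x \<sqinter> y) \<squnion> (x \<sqinter> z)"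

locale finite_valuation = lower_bounded_distributive_lattice +
  fixes \<mu> :: "'a \<Rightarrow> ennreal"
  assumes valuation_finite: "p \<in> carrier L \<Longrightarrow> \<mu> p < \<infinity>"
    and valuation_mono: "\<lbrakk>p \<in> carrier L; q \<in> carrier L; p \<sqsubseteq> q\<rbrakk> \<Longrightarrow> \<mu> p \<le> \<mu> q"
    and valuation_bottom: "\<mu> \<bottom> = 0"
    and valuation_modular:
    "\<lbrakk>p \<in> carrier L; q \<in> carrier L\<rbrakk> \<Longrightarrow> \<mu> p + \<mu> q = \<mu> (p \<squnion> q) + \<mu> (p \<sqinter> q)"

text \<open>
  A family of elements below \<open>p\<close> is given by the set \<open>S\<close> of its members. The supremum of the
  empty family is \<open>\<bottom>\<close>. For a finite valuation the truncated subtraction on \<^typ>\<open>ennreal\<close> is the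
  ordinary one here, because \<open>\<mu> (\<Squnion>T) \<le> \<mu> p < \<infinity>\<close>.
\<close>

definition inner_cover ::
  "('a, 'c) gorder_scheme \<Rightarrow> ('a \<Rightarrow> ennreal) \<Rightarrow> 'a \<Rightarrow> 'a set \<Rightarrow> bool" where
  "inner_cover D \<mu> p S \<longleftrightarrow>
    S \<subseteq> {q \<in> carrier D. q \<sqsubseteq>\<^bsub>D\<^esub> p} \<and>
    (\<forall>\<epsilon>>0. \<exists>T. finite T \<and> T \<subseteq> S \<and> \<mu> p - \<mu> (\<Squnion>\<^bsub>D\<^esub>T) < \<epsilon>)"

definition valuation_ideal ::
  "('a, 'c) gorder_scheme \<Rightarrow> ('a \<Rightarrow> ennreal) \<Rightarrow> 'a set \<Rightarrow> bool" where
  "valuation_ideal D \<mu> U \<longleftrightarrow>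
    U \<subseteq> carrier D \<and>
    (\<forall>p\<in>U. \<forall>q\<in>carrier D. q \<sqsubseteq>\<^bsub>D\<^esub> p \<longrightarrow> q \<in> U) \<and>
    (\<forall>p\<in>carrier D. \<forall>S. S \<subseteq> U \<and> inner_cover D \<mu> p S \<longrightarrow> p \<in> U)"

definition valuation_locale ::
  "('a, 'c) gorder_scheme \<Rightarrow> ('a \<Rightarrow> ennreal) \<Rightarrow> 'a set gorder" where
  "valuation_locale D \<mu> = \<lparr>carrier = {U. valuation_ideal D \<mu> U}, eq = (=), le = (\<subseteq>)\<rparr>"

definition inner_measure :: "('a \<Rightarrow> ennreal) \<Rightarrow> 'a set \<Rightarrow> ennreal" where
  "inner_measure \<mu> U = (SUP p\<in>U. \<mu> p)"


section \<open>Radon measures\<close>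

locale radon_measure = complete_measure M for X :: "'a topology" and M :: "'a measure" +
  assumes Hausdorff: "Hausdorff_space X"
    and space_eq: "space M = topspace X"
    and open_measurable: "openin X U \<Longrightarrow> U \<in> sets M"
    and locally_determined:
    "\<lbrakk>E \<subseteq> topspace X; \<And>F. \<lbrakk>F \<in> sets M; emeasure M F < \<infinity>\<rbrakk> \<Longrightarrow> E \<inter> F \<in> sets M\<rbrakk> \<Longrightarrow> E \<in> sets M"
    and inner_regular:
    "E \<in> sets M \<Longrightarrow> emeasure M E = (SUP C\<in>{C. C \<subseteq> E \<and> compactin X C}. emeasure M C)"
    and locally_finite:
    "x \<in> topspace X \<Longrightarrow> \<exists>U. openin X U \<and> x \<in> U \<and> emeasure M U < \<infinity>"

definition compact_lattice :: "'a topology \<Rightarrow> 'a set gorder" where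
  "compact_lattice X = \<lparr>carrier = {C. compactin X C}, eq = (=), le = (\<subseteq>)\<rparr>"

definition almost_equal :: "'a measure \<Rightarrow> ('a set \<times> 'a set) set" where
  "almost_equal M = {(A, B). A \<in> sets M \<and> B \<in> sets M \<and> sym_diff A B \<in> null_sets M}"

definition measure_algebra :: "'a measure \<Rightarrow> 'a set set gorder" where
  "measure_algebra M =
    \<lparr>carrier = sets M // almost_equal M, eq = (=),
     le = (\<lambda>P Q. \<exists>A\<in>P. \<exists>B\<in>Q. A - B \<in> null_sets M)\<rparr>"

text \<open>The common value of \<^term>\<open>emeasure M\<close> on the members of the class.\<close>

definition measure_algebra_measure :: "'a measure \<Rightarrow> 'a set set \<Rightarrow> ennreal" where
  "measure_algebra_measure M P = the_elem (emeasure M ` P)"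

context radon_measure
begin

lemma compact_measurable: "compactin X C \<Longrightarrow> C \<in> sets M"
proof -
  assume "compactin X C"
  then have "closedin X C" using Hausdorff compactin_imp_closedin by blast
  then have "C = space M - (topspace X - C)" "openin X (topspace X - C)"
    using space_eq closedin_subset by fastforce+
  then show "C \<in> sets M" using open_measurable by (metis sets.compl_sets)
qed

lemma compact_finite:
  assumes C: "compactin X C" shows "emeasure M C < \<infinity>"
proof -
  define \<U> where "\<U> = {U. openin X U \<and> emeasure M U < \<infinity>}"
  have "C \<subseteq> \<Union>\<U>"
    using locally_finite compactin_subset_topspace[OF C] unfolding \<U>_def by fast
  then obtain \<F> where F: "finite \<F>" "\<F> \<subseteq> \<U>" "C \<subseteq> \<Union>\<F>"
    using C unfolding compactin_def \<U>_def by (metis (no_types, lifting) mem_Collect_eq)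
  have m: "U \<in> sets M" if "U \<in> \<F>" for U using that F open_measurable by (auto simp: \<U>_def)
  have "emeasure M C \<le> emeasure M (\<Union>\<F>)"
    using F m by (intro emeasure_mono) auto
  also have "\<dots> \<le> (\<Sum>U\<in>\<F>. emeasure M U)"
    using emeasure_subadditive_finite[of \<F> "\<lambda>U. U" M] F m by auto
  also have "\<dots> < \<infinity>" using F by (auto simp: \<U>_def)
  finally show ?thesis .
qed

lemma compact_lattice_least:
  "\<lbrakk>compactin X C; compactin X D\<rbrakk> \<Longrightarrow>
     least (compact_lattice X) (C \<union> D) (Upper (compact_lattice X) {C, D})"
  by (auto simp: least_def Upper_def compact_lattice_def compactin_Un)

lemma compact_lattice_greatest:
  "\<lbrakk>compactin X C; compactin X D\<rbrakk> \<Longrightarrow>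
     greatest (compact_lattice X) (C \<inter> D) (Lower (compact_lattice X) {C, D})"
  using closed_Int_compactin[OF compactin_imp_closedin[OF Hausdorff]]
  by (auto simp: greatest_def Lower_def compact_lattice_def)

lemma lattice_compact_lattice: "lattice (compact_lattice X)"
proof unfold_locales
  show "\<exists>s. least (compact_lattice X) s (Upper (compact_lattice X) {C, D})"
    if "C \<in> carrier (compact_lattice X)" "D \<in> carrier (compact_lattice X)" for C D
    using that compact_lattice_least by (auto simp: compact_lattice_def)
  show "\<exists>s. greatest (compact_lattice X) s (Lower (compact_lattice X) {C, D})"
    if "C \<in> carrier (compact_lattice X)" "D \<in> carrier (compact_lattice X)" for C D
    using that compact_lattice_greatest by (auto simp: compact_lattice_def)
qed (auto simp: compact_lattice_def)

lemma compact_lattice_join: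
  assumes "compactin X C" "compactin X D"
  shows "C \<squnion>\<^bsub>compact_lattice X\<^esub> D = C \<union> D"
proof -
  interpret lattice "compact_lattice X" by (rule lattice_compact_lattice)
  show ?thesis
    using least_unique[OF _ compact_lattice_least[OF assms]] compact_lattice_least[OF assms]
    unfolding join_def sup_def by (metis someI)
qed

lemma compact_lattice_meet:
  assumes "compactin X C" "compactin X D"
  shows "C \<sqinter>\<^bsub>compact_lattice X\<^esub> D = C \<inter> D"
proof -
  interpret lattice "compact_lattice X" by (rule lattice_compact_lattice)
  show ?thesis
    using greatest_unique[OF _ compact_lattice_greatest[OF assms]]
      compact_lattice_greatest[OF assms]
    unfolding meet_def inf_def by (metis someI)
qed

lemma compact_lattice_bottom: "\<bottom>\<^bsub>compact_lattice X\<^esub> = {}"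
proof -
  have "least (compact_lattice X) x (carrier (compact_lattice X)) \<longleftrightarrow> x = {}" for x
    by (auto simp: least_def compact_lattice_def)
  then show ?thesis by (simp add: bottom_def)
qed

lemma finite_valuation_compact_lattice: "finite_valuation (compact_lattice X) (emeasure M)"
proof -
  interpret lattice "compact_lattice X" by (rule lattice_compact_lattice)
  have K: "compactin X C" if "C \<in> carrier (compact_lattice X)" for C
    using that by (simp add: compact_lattice_def)
  have Un: "compactin X (C \<union> D)" and Int: "compactin X (C \<inter> D)"
    if "compactin X C" "compactin X D" for C D
    using that compact_lattice_greatest[OF that]
    by (auto simp: compactin_Un greatest_def Lower_def compact_lattice_def)
  show ?thesis
  proof unfold_locales
    show "\<exists>x. least (compact_lattice X) x (carrier (compact_lattice X))"
      by (auto simp: least_def compact_lattice_def intro!: exI[of _ "{}"])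
    fix C D E assume "C \<in> carrier (compact_lattice X)" "D \<in> carrier (compact_lattice X)"
      "E \<in> carrier (compact_lattice X)"
    then show "C \<sqinter>\<^bsub>compact_lattice X\<^esub> (D \<squnion>\<^bsub>compact_lattice X\<^esub> E) =
      C \<sqinter>\<^bsub>compact_lattice X\<^esub> D \<squnion>\<^bsub>compact_lattice X\<^esub> (C \<sqinter>\<^bsub>compact_lattice X\<^esub> E)"
      by (simp add: K Un Int compact_lattice_join compact_lattice_meet Int_Un_distrib)
  next
    fix C assume "C \<in> carrier (compact_lattice X)"
    then show "emeasure M C < \<infinity>" using K compact_finite by blast
  next
    fix C D assume "C \<in> carrier (compact_lattice X)" "D \<in> carrier (compact_lattice X)"
      "C \<sqsubseteq>\<^bsub>compact_lattice X\<^esub> D"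
    then show "emeasure M C \<le> emeasure M D"
      using compact_measurable by (intro emeasure_mono) (auto simp: compact_lattice_def)
  next
    show "emeasure M \<bottom>\<^bsub>compact_lattice X\<^esub> = 0" by (simp add: compact_lattice_bottom)
  next
    fix C D assume "C \<in> carrier (compact_lattice X)" "D \<in> carrier (compact_lattice X)"
    then show "emeasure M C + emeasure M D =
      emeasure M (C \<squnion>\<^bsub>compact_lattice X\<^esub> D) + emeasure M (C \<sqinter>\<^bsub>compact_lattice X\<^esub> D)"
      using emeasure_Un_Int[of C M D] compact_measurable
      by (simp add: K compact_lattice_join compact_lattice_meet)
  qed
qed

end

end

theory Submission
  imports Defs
begin

text \<open>
  A measurable set \<open>E\<close> gives the ideal of all compact \<open>C\<close> for which \<open>C - E\<close> is null
  (\<open>compact_part\<close>). This assignment turns out to be an order isomorphism from the measure algebra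
  onto the frame of ideals, and it carries \<open>emeasure M E\<close> to the inner measure of the ideal. Both
  the order and the measure are recovered from the ideal by inner regularity: a non-null set
  contains a compact set of positive measure (\<open>compact_part_subset_iff\<close>), and the measure of \<open>E\<close> is
  the supremum over its compact subsets (\<open>inner_measure_compact_part\<close>).

  The substance is surjectivity (\<open>compact_ideal_eq_compact_part\<close>). Given an ideal \<open>U\<close>, Zorn's
  lemma provides a maximal disjoint family of members of \<open>U\<close> that are self-supporting, that is,
  equal to the support of the measure on them. By local finiteness a compact set meets only
  countably many of them, so their union \<open>E\<close> is measurable by completeness and local determinedness.
  Maximality forces every member of \<open>U\<close> into \<open>E\<close> up to a null set, and a compact set inside \<open>E\<close> up
  to a null set is inner covered by its traces on countably many members of the family.

  Surjectivity also makes the measure algebra complete: intersections of ideals are ideals, so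
  infima of classes exist (\<open>complete_lattice_measure_algebra\<close>). Its finite operations are those of
  sets, hence it is a complete Boolean algebra and therefore a frame. Modularity of
  the measure is checked on sets; continuity along directed suprema is checked on ideals, where the
  join of a directed family consists of the compact sets approximable in measure from inside by
  members of the family (\<open>measure_algebra_measure_directed_Sup\<close>). An order isomorphism preserves all
  of this structure, so the frame of ideals with its inner measure is isomorphic, as a frame with a
  measure, to the measure algebra (\<open>measure_preserving_locale_iso\<close>).
\<close>

section \<open>Complete Boolean algebras are frames\<close>

lemma (in complete_lattice) sup_eqI:
  assumes "least L s (Upper L A)"
  shows "\<Squnion>A = s"
  using assms least_unique unfolding sup_def by (metis someI)

lemma (in complete_lattice) inf_eqI:
  assumes "greatest L i (Lower L A)"
  shows "\<Sqinter>A = i"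
  using assms greatest_unique unfolding inf_def by (metis someI)

context complete_boolean_algebra
begin

text \<open>
  With a complement \<open>y\<close> of \<open>V\<close>, an inequality \<open>V \<sqinter> U \<sqsubseteq> s\<close> is equivalent to
  \<open>U \<sqsubseteq> s \<squnion> y\<close>, and the latter form passes to suprema in \<open>U\<close>.
\<close>
lemma meet_Sup_le:
  assumes V: "V \<in> carrier L" and A: "A \<subseteq> carrier L"
  shows "V \<sqinter> (\<Squnion>A) \<sqsubseteq> \<Squnion>((\<lambda>U. V \<sqinter> U) ` A)"
proof -
  define s where "s = \<Squnion>((\<lambda>U. V \<sqinter> U) ` A)"
  have VA: "(\<lambda>U. V \<sqinter> U) ` A \<subseteq> carrier L" using V A by auto
  then have s: "s \<in> carrier L" by (simp add: s_def)
  obtain y where y: "y \<in> carrier L" "V \<sqinter> y = \<bottom>" "V \<squnion> y = \<top>"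
    using complement_exists[OF V] by blast
  have "U \<sqsubseteq> s \<squnion> y" if U: "U \<in> A" for U
  proof -
    have Uc: "U \<in> carrier L" using U A by auto
    have "U = U \<sqinter> (V \<squnion> y)"
      using Uc y V by (metis le_iff_join top_closed top_higher)
    also have "\<dots> = (U \<sqinter> V) \<squnion> (U \<sqinter> y)" using inf_sup_distrib[OF Uc V y(1)] .
    also have "\<dots> \<sqsubseteq> s \<squnion> y"
    proof (rule join_le)
      have "V \<sqinter> U \<sqsubseteq> s" unfolding s_def using VA U by (intro sup_upper) auto
      then show "U \<sqinter> V \<sqsubseteq> s \<squnion> y"
        using le_trans[OF _ join_left[OF s y(1)]] s y V Uc by (simp add: meet_comm[of _ U V])
      show "U \<sqinter> y \<sqsubseteq> s \<squnion> y"
        using le_trans[OF meet_right[OF Uc y(1)] join_right[OF s y(1)]] s y Uc by simp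
    qed (use s y V Uc in auto)
    finally show ?thesis .
  qed
  then have "\<Squnion>A \<sqsubseteq> s \<squnion> y" using A s y by (intro sup_least) auto
  then have "V \<sqinter> (\<Squnion>A) \<sqsubseteq> V \<sqinter> (s \<squnion> y)"
    using V A s y by (meson join_closed le_trans meet_closed meet_le meet_left meet_right sup_closed)
  also have "V \<sqinter> (s \<squnion> y) = (V \<sqinter> s) \<squnion> \<bottom>"
    using inf_sup_distrib[OF V s y(1)] y by simp
  also have "\<dots> \<sqsubseteq> s"
    using V s by (intro join_le meet_right) auto
  finally show ?thesis using V A s y by (simp add: s_def)
qed

lemma frame: "frame L"
proof unfold_locales
  fix V A assume V: "V \<in> carrier L" and A: "A \<subseteq> carrier L"
  have VA: "(\<lambda>U. V \<sqinter> U) ` A \<subseteq> carrier L" using V A by auto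
  have "\<Squnion>((\<lambda>U. V \<sqinter> U) ` A) \<sqsubseteq> V \<sqinter> (\<Squnion>A)"
  proof (rule sup_least[OF VA])
    fix x assume "x \<in> (\<lambda>U. V \<sqinter> U) ` A"
    then obtain U where U: "U \<in> A" "x = V \<sqinter> U" by auto
    then have Uc: "U \<in> carrier L" "U \<sqsubseteq> \<Squnion>A" using A sup_upper by auto
    then show "x \<sqsubseteq> V \<sqinter> (\<Squnion>A)"
      using U V A by (metis le_trans meet_closed meet_le meet_left meet_right sup_closed)
  qed (use V A in auto)
  then show "V \<sqinter> (\<Squnion>A) = \<Squnion>((\<lambda>U. V \<sqinter> U) ` A)"
    using meet_Sup_le[OF V A] V A VA by (intro le_antisym) auto
qed

end

section \<open>Transport of frames and measures along order isomorphisms\<close>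

locale order_isomorphism = source: partial_order F + target: partial_order G
  for F :: "('a, 'c) gorder_scheme" (structure) and G :: "('b, 'd) gorder_scheme" (structure) +
  fixes h :: "'a \<Rightarrow> 'b"
  assumes bij: "bij_betw h (carrier F) (carrier G)"
    and le_iff: "\<lbrakk>x \<in> carrier F; y \<in> carrier F\<rbrakk> \<Longrightarrow> h x \<sqsubseteq>\<^bsub>G\<^esub> h y \<longleftrightarrow> x \<sqsubseteq>\<^bsub>F\<^esub> y"
begin

lemma h_closed: "x \<in> carrier F \<Longrightarrow> h x \<in> carrier G"
  using bij by (auto simp: bij_betw_def)

lemma surjE:
  assumes "y \<in> carrier G" obtains x where "x \<in> carrier F" "y = h x"
  using assms bij by (auto simp: bij_betw_def)

lemma image_carrierE:
  assumes "B \<subseteq> carrier G" obtains A where "A \<subseteq> carrier F" "B = h ` A"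
  using assms bij by (metis bij_betw_def subset_image_iff)

text \<open>
  The inverse is again an order isomorphism, so that each transport result below, stated from
  \<open>F\<close> to \<open>G\<close>, serves in both directions.
\<close>
lemma order_isomorphism_inverse: "order_isomorphism G F (inv_into (carrier F) h)"
proof unfold_locales
  show "bij_betw (inv_into (carrier F) h) (carrier G) (carrier F)"
    using bij by (rule bij_betw_inv_into)
  show "inv_into (carrier F) h x \<sqsubseteq>\<^bsub>F\<^esub> inv_into (carrier F) h y \<longleftrightarrow> x \<sqsubseteq>\<^bsub>G\<^esub> y"
    if "x \<in> carrier G" "y \<in> carrier G" for x y
    using that le_iff[of "inv_into (carrier F) h x" "inv_into (carrier F) h y"]
      bij_betwE[OF bij_betw_inv_into[OF bij]] by (simp add: bij_betw_inv_into_right[OF bij])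
qed

lemma least_image:
  assumes "A \<subseteq> carrier F" "least F s (Upper F A)"
  shows "least G (h s) (Upper G (h ` A))"
proof -
  have s: "s \<in> carrier F" "\<And>x. x \<in> A \<Longrightarrow> x \<sqsubseteq>\<^bsub>F\<^esub> s"
    "\<And>u. u \<in> carrier F \<Longrightarrow> (\<And>x. x \<in> A \<Longrightarrow> x \<sqsubseteq>\<^bsub>F\<^esub> u) \<Longrightarrow> s \<sqsubseteq>\<^bsub>F\<^esub> u"
    using assms by (auto simp: least_def Upper_def)
  show ?thesis
    unfolding least_def Upper_def
  proof (intro conjI ballI)
    show "h s \<in> {u. \<forall>x. x \<in> h ` A \<inter> carrier G \<longrightarrow> x \<sqsubseteq>\<^bsub>G\<^esub> u} \<inter> carrier G"
      using s(1,2) assms(1) by (auto simp: h_closed le_iff subset_iff)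
    fix v assume v: "v \<in> {u. \<forall>x. x \<in> h ` A \<inter> carrier G \<longrightarrow> x \<sqsubseteq>\<^bsub>G\<^esub> u} \<inter> carrier G"
    then obtain u where u: "u \<in> carrier F" "v = h u" using surjE by blast
    have "x \<sqsubseteq>\<^bsub>F\<^esub> u" if "x \<in> A" for x
      using that v u assms(1) h_closed le_iff by (auto simp: subset_iff)
    then show "h s \<sqsubseteq>\<^bsub>G\<^esub> v" using u s by (simp add: le_iff)
  qed auto
qed

lemma greatest_image:
  assumes "A \<subseteq> carrier F" "greatest F s (Lower F A)"
  shows "greatest G (h s) (Lower G (h ` A))"
proof -
  have s: "s \<in> carrier F" "\<And>x. x \<in> A \<Longrightarrow> s \<sqsubseteq>\<^bsub>F\<^esub> x"
    "\<And>u. u \<in> carrier F \<Longrightarrow> (\<And>x. x \<in> A \<Longrightarrow> u \<sqsubseteq>\<^bsub>F\<^esub> x) \<Longrightarrow> u \<sqsubseteq>\<^bsub>F\<^esub> s"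
    using assms by (auto simp: greatest_def Lower_def)
  show ?thesis
    unfolding greatest_def Lower_def
  proof (intro conjI ballI)
    show "h s \<in> {u. \<forall>x. x \<in> h ` A \<inter> carrier G \<longrightarrow> u \<sqsubseteq>\<^bsub>G\<^esub> x} \<inter> carrier G"
      using s(1,2) assms(1) by (auto simp: h_closed le_iff subset_iff)
    fix v assume v: "v \<in> {u. \<forall>x. x \<in> h ` A \<inter> carrier G \<longrightarrow> u \<sqsubseteq>\<^bsub>G\<^esub> x} \<inter> carrier G"
    then obtain u where u: "u \<in> carrier F" "v = h u" using surjE by blast
    have "u \<sqsubseteq>\<^bsub>F\<^esub> x" if "x \<in> A" for x
      using that v u assms(1) h_closed le_iff by (auto simp: subset_iff)
    then show "v \<sqsubseteq>\<^bsub>G\<^esub> h s" using u s by (simp add: le_iff)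
  qed auto
qed

lemma complete_lattice_target:
  assumes "complete_lattice F" shows "complete_lattice G"
proof -
  interpret F: complete_lattice F by fact
  show ?thesis
  proof unfold_locales
    fix B assume "B \<subseteq> carrier G"
    then obtain A where A: "A \<subseteq> carrier F" "B = h ` A" using image_carrierE by blast
    show "\<exists>s. least G s (Upper G B)" using least_image F.sup_lub A by blast
    show "\<exists>s. greatest G s (Lower G B)" using greatest_image F.inf_glb A by blast
  qed
qed

end

text \<open>
  Completeness is demanded of the source only; the target inherits it. Suprema, finite infima and
  bounds are determined by the order, hence preserved, and with them all the structure of a frame
  with a measure.
\<close>
locale complete_lattice_isomorphism = order_isomorphism F G h + source: complete_lattice F
  for F :: "('a, 'c) gorder_scheme" (structure) and G :: "('b, 'd) gorder_scheme" (structure)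
    and h :: "'a \<Rightarrow> 'b"

sublocale complete_lattice_isomorphism \<subseteq> target: complete_lattice G
  using complete_lattice_target source.complete_lattice_axioms by blast

context complete_lattice_isomorphism
begin

lemma image_Sup: "A \<subseteq> carrier F \<Longrightarrow> h (\<Squnion>\<^bsub>F\<^esub>A) = \<Squnion>\<^bsub>G\<^esub>(h ` A)"
  using least_image[OF _ source.sup_lub] target.sup_eqI by metis

lemma image_join: "\<lbrakk>x \<in> carrier F; y \<in> carrier F\<rbrakk> \<Longrightarrow> h (x \<squnion>\<^bsub>F\<^esub> y) = h x \<squnion>\<^bsub>G\<^esub> h y"
  using image_Sup[of "{x, y}"] by (simp add: join_def)

lemma image_inf:
  assumes "x \<in> carrier F" "y \<in> carrier F"
  shows "h (x \<sqinter>\<^bsub>F\<^esub> y) = h x \<sqinter>\<^bsub>G\<^esub> h y"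
proof -
  have "greatest G (h (x \<sqinter>\<^bsub>F\<^esub> y)) (Lower G (h ` {x, y}))"
    unfolding meet_def by (intro greatest_image source.inf_glb) (use assms in auto)
  then show ?thesis
    unfolding meet_def[of G] using target.inf_eqI by fastforce
qed

lemma image_top: "h \<top>\<^bsub>F\<^esub> = \<top>\<^bsub>G\<^esub>"
proof -
  have "\<Squnion>\<^bsub>F\<^esub>(carrier F) = \<top>\<^bsub>F\<^esub>" "\<Squnion>\<^bsub>G\<^esub>(carrier G) = \<top>\<^bsub>G\<^esub>"
    using source.weak_sup_carrier target.weak_sup_carrier
    by (simp_all only: source.eq_is_equal target.eq_is_equal)
  then show ?thesis
    using image_Sup[of "carrier F"] bij_betw_imp_surj_on[OF bij] by simp
qed

lemma image_bottom: "h \<bottom>\<^bsub>F\<^esub> = \<bottom>\<^bsub>G\<^esub>"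
proof -
  have "\<Squnion>\<^bsub>F\<^esub>{} = \<bottom>\<^bsub>F\<^esub>" "\<Squnion>\<^bsub>G\<^esub>{} = \<bottom>\<^bsub>G\<^esub>"
    using source.weak_sup_empty target.weak_sup_empty
    by (simp_all only: source.eq_is_equal target.eq_is_equal)
  then show ?thesis
    using image_Sup[of "{}"] by simp
qed

lemma frame_target:
  assumes "frame F" shows "frame G"
proof -
  interpret F: frame F by fact
  show ?thesis
  proof unfold_locales
    fix V B assume "V \<in> carrier G" "B \<subseteq> carrier G"
    then obtain U A where U: "U \<in> carrier F" "V = h U" and A: "A \<subseteq> carrier F" "B = h ` A"
      using surjE image_carrierE by metis
    have UA: "(\<lambda>W. U \<sqinter>\<^bsub>F\<^esub> W) ` A \<subseteq> carrier F" using U A by auto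
    have "V \<sqinter>\<^bsub>G\<^esub> (\<Squnion>\<^bsub>G\<^esub>B) = h (U \<sqinter>\<^bsub>F\<^esub> (\<Squnion>\<^bsub>F\<^esub>A))"
      using U A by (simp add: image_inf image_Sup)
    also have "\<dots> = h (\<Squnion>\<^bsub>F\<^esub>((\<lambda>W. U \<sqinter>\<^bsub>F\<^esub> W) ` A))"
      using U(1) A(1) by (simp only: F.inf_Sup_distrib)
    also have "\<dots> = \<Squnion>\<^bsub>G\<^esub>((\<lambda>W. V \<sqinter>\<^bsub>G\<^esub> W) ` B)"
      unfolding image_Sup[OF UA] image_image A(2) U(2) using image_inf U(1) A(1)
      by (intro arg_cong[of _ _ "\<lambda>S. \<Squnion>\<^bsub>G\<^esub>S"] image_cong) auto
    finally show "V \<sqinter>\<^bsub>G\<^esub> (\<Squnion>\<^bsub>G\<^esub>B) = \<Squnion>\<^bsub>G\<^esub>((\<lambda>W. V \<sqinter>\<^bsub>G\<^esub> W) ` B)" .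
  qed
qed

lemma frame_hom:
  assumes "frame F" shows "frame_hom F G h"
proof -
  interpret F: frame F by fact
  interpret G: frame G using frame_target[OF assms] .
  show ?thesis
    by unfold_locales (auto simp: h_closed image_Sup image_top image_inf)
qed

lemma measured_frame_target:
  assumes "measured_frame F \<nu>" and \<nu>: "\<And>x. x \<in> carrier F \<Longrightarrow> \<nu>' (h x) = \<nu> x"
  shows "measured_frame G \<nu>'"
proof -
  interpret F: measured_frame F \<nu> by fact
  interpret G: frame G using frame_target F.frame_axioms by blast
  show ?thesis
  proof unfold_locales
    fix U V assume UV: "U \<in> carrier G" "V \<in> carrier G"
    then obtain u v where u: "u \<in> carrier F" "U = h u" and v: "v \<in> carrier F" "V = h v"
      using surjE by metis
    show "\<nu>' U \<le> \<nu>' V" if "U \<sqsubseteq>\<^bsub>G\<^esub> V"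
      using that u v F.measure_mono le_iff \<nu> by auto
    show "\<nu>' U + \<nu>' V = \<nu>' (U \<squnion>\<^bsub>G\<^esub> V) + \<nu>' (U \<sqinter>\<^bsub>G\<^esub> V)"
      using F.measure_modular[OF u(1) v(1)] u v
      by (simp add: \<nu> image_join[symmetric] image_inf[symmetric])
  next
    show "\<nu>' \<bottom>\<^bsub>G\<^esub> = 0"
      using F.measure_bottom by (simp add: \<nu> flip: image_bottom)
  next
    fix B assume B: "directed_subset G B"
    then obtain A where A: "A \<subseteq> carrier F" "B = h ` A"
      using image_carrierE unfolding directed_subset_def by blast
    have "\<exists>z\<in>A. x \<sqsubseteq>\<^bsub>F\<^esub> z \<and> y \<sqsubseteq>\<^bsub>F\<^esub> z" if xy: "x \<in> A" "y \<in> A" for x y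
    proof -
      obtain z where z: "z \<in> A" "h x \<sqsubseteq>\<^bsub>G\<^esub> h z" "h y \<sqsubseteq>\<^bsub>G\<^esub> h z"
        using B A(2) xy unfolding directed_subset_def by blast
      then have "x \<sqsubseteq>\<^bsub>F\<^esub> z" "y \<sqsubseteq>\<^bsub>F\<^esub> z"
        using le_iff A(1) xy by (simp_all add: subset_iff)
      then show ?thesis using z(1) by blast
    qed
    then have "directed_subset F A"
      using A B by (auto simp: directed_subset_def)
    then have "\<nu>' (\<Squnion>\<^bsub>G\<^esub>B) = (SUP U\<in>A. \<nu> U)"
      using F.measure_directed_Sup[of A] \<nu>[of "\<Squnion>\<^bsub>F\<^esub>A"] image_Sup[OF A(1)] A by simp
    also have "\<dots> = (SUP V\<in>B. \<nu>' V)"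
      using A \<nu> by (auto simp: image_image subset_iff intro!: SUP_cong)
    finally show "\<nu>' (\<Squnion>\<^bsub>G\<^esub>B) = (SUP V\<in>B. \<nu>' V)" .
  qed
qed

lemma measure_preserving_locale_iso:
  assumes F: "measured_frame F \<nu>" and \<nu>: "\<And>x. x \<in> carrier F \<Longrightarrow> \<nu>' (h x) = \<nu> x"
  shows "measure_preserving_locale_iso G \<nu>' F \<nu>"
proof -
  have G: "measured_frame G \<nu>'" using measured_frame_target F \<nu> .
  have frames: "frame F" "frame G"
    using F G by (auto simp: measured_frame_def)
  interpret inverse: order_isomorphism G F "inv_into (carrier F) h"
    by (rule order_isomorphism_inverse)
  interpret inverse: complete_lattice_isomorphism G F "inv_into (carrier F) h"
    by unfold_locales
  have inv: "h (inv_into (carrier F) h U) = U" if "U \<in> carrier G" for U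
    using that bij by (simp add: bij_betw_inv_into_right)
  have "measure_preserving_locale_map G \<nu>' F \<nu> h"
    using F G \<nu> frame_hom[OF frames(1)]
    by (auto simp: measure_preserving_locale_map_def locale_map_def)
  moreover have "measure_preserving_locale_map F \<nu> G \<nu>' (inv_into (carrier F) h)"
    unfolding measure_preserving_locale_map_def locale_map_def
  proof (intro conjI ballI)
    fix V assume "V \<in> carrier G"
    then show "\<nu> (inv_into (carrier F) h V) = \<nu>' V"
      using \<nu> inverse.h_closed inv by metis
  qed (use F G inverse.frame_hom[OF frames(2)] in auto)
  ultimately show ?thesis
    unfolding measure_preserving_locale_iso_def
    using inv bij_betw_inv_into_left[OF bij]
    by (intro exI[of _ h] exI[of _ "inv_into (carrier F) h"]) simp
qed

end

section \<open>The measure algebra and representatives\<close>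

definition measure_class :: "'a measure \<Rightarrow> 'a set \<Rightarrow> 'a set set" where
  "measure_class M A = almost_equal M `` {A}"

lemma almost_equal_iff:
  "(A, B) \<in> almost_equal M \<longleftrightarrow>
     A \<in> sets M \<and> B \<in> sets M \<and> A - B \<in> null_sets M \<and> B - A \<in> null_sets M"
proof -
  have "A - B \<in> null_sets M \<and> B - A \<in> null_sets M"
    if "A \<in> sets M" "B \<in> sets M" "sym_diff A B \<in> null_sets M"
    using that null_sets_subset[OF that(3), of "A - B"] null_sets_subset[OF that(3), of "B - A"]
    by auto
  then show ?thesis by (auto simp: almost_equal_def)
qed

lemma null_diff_subset: "A \<subseteq> B \<Longrightarrow> A - B \<in> null_sets M"
  by (metis Diff_eq_empty_iff null_sets.empty_sets)

lemma null_diff_trans: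
  assumes "A \<in> sets M" "C \<in> sets M" "A - B \<in> null_sets M" "B - C \<in> null_sets M"
  shows "A - C \<in> null_sets M"
  by (rule null_sets_subset[OF null_sets.Un[OF assms(3,4)]]) (use assms in auto)

lemma equiv_almost_equal: "equiv (sets M) (almost_equal M)"
proof (rule equivI)
  show "almost_equal M \<subseteq> sets M \<times> sets M" by (auto simp: almost_equal_def)
  show "refl_on (sets M) (almost_equal M)" by (auto simp: refl_on_def almost_equal_iff)
  show "sym (almost_equal M)" by (auto simp: sym_def almost_equal_iff)
  show "trans (almost_equal M)"
    by (auto simp: trans_def almost_equal_iff intro: null_diff_trans)
qed

lemma measure_class_carrier: "A \<in> sets M \<Longrightarrow> measure_class M A \<in> carrier (measure_algebra M)"
  by (auto simp: measure_algebra_def measure_class_def intro: quotientI)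

lemma measure_algebraE:
  assumes "P \<in> carrier (measure_algebra M)"
  obtains A where "A \<in> sets M" "P = measure_class M A"
  using assms by (auto simp: measure_algebra_def measure_class_def elim: quotientE)

lemma measure_class_self: "A \<in> sets M \<Longrightarrow> A \<in> measure_class M A"
  unfolding measure_class_def using equiv_class_self[OF equiv_almost_equal] .

text \<open>
  The order on classes asks for one pair of representatives whose difference is null; transitivity
  of having null difference makes the choice of representatives immaterial.
\<close>
lemma measure_class_le_iff:
  assumes A: "A \<in> sets M" and B: "B \<in> sets M"
  shows "measure_class M A \<sqsubseteq>\<^bsub>measure_algebra M\<^esub> measure_class M B \<longleftrightarrow> A - B \<in> null_sets M"
proof
  assume "measure_class M A \<sqsubseteq>\<^bsub>measure_algebra M\<^esub> measure_class M B"
  then obtain A' B' where "(A, A') \<in> almost_equal M" "(B, B') \<in> almost_equal M"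
    "A' - B' \<in> null_sets M"
    by (auto simp: measure_algebra_def measure_class_def)
  then show "A - B \<in> null_sets M"
    by (meson almost_equal_iff null_diff_trans)
next
  assume "A - B \<in> null_sets M"
  then show "measure_class M A \<sqsubseteq>\<^bsub>measure_algebra M\<^esub> measure_class M B"
    using measure_class_self[OF A] measure_class_self[OF B] by (auto simp: measure_algebra_def)
qed

lemma measure_class_eq_iff:
  assumes "A \<in> sets M" "B \<in> sets M"
  shows "measure_class M A = measure_class M B \<longleftrightarrow> A - B \<in> null_sets M \<and> B - A \<in> null_sets M"
  using eq_equiv_class_iff[OF equiv_almost_equal assms] assms
  by (simp add: almost_equal_iff measure_class_def)

lemma measure_algebra_measure_class:
  assumes A: "A \<in> sets M"
  shows "measure_algebra_measure M (measure_class M A) = emeasure M A"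
proof -
  have "emeasure M B = emeasure M A" if "B \<in> measure_class M A" for B
  proof -
    have "AE x in M. x \<in> A \<longleftrightarrow> x \<in> B"
      using that by (intro AE_I'[of "sym_diff A B"]) (auto simp: almost_equal_def measure_class_def)
    then show ?thesis
      using that by (intro emeasure_eq_AE) (auto simp: almost_equal_def measure_class_def)
  qed
  then have "emeasure M ` measure_class M A = {emeasure M A}"
    using measure_class_self[OF A] by (metis image_constant image_cong)
  then show ?thesis by (simp add: measure_algebra_measure_def)
qed

lemma partial_order_measure_algebra: "partial_order (measure_algebra M)"
proof unfold_locales
  fix P Q R
  assume P: "P \<in> carrier (measure_algebra M)" and Q: "Q \<in> carrier (measure_algebra M)"
  obtain A where A: "A \<in> sets M" "P = measure_class M A" using P by (rule measure_algebraE)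
  obtain B where B: "B \<in> sets M" "Q = measure_class M B" using Q by (rule measure_algebraE)
  show "P .=\<^bsub>measure_algebra M\<^esub> Q"
    if "P \<sqsubseteq>\<^bsub>measure_algebra M\<^esub> Q" "Q \<sqsubseteq>\<^bsub>measure_algebra M\<^esub> P"
  proof -
    have "P = Q" using that A B by (simp add: measure_class_le_iff measure_class_eq_iff)
    then show ?thesis by (simp add: measure_algebra_def)
  qed
  assume R: "R \<in> carrier (measure_algebra M)"
  obtain C where C: "C \<in> sets M" "R = measure_class M C" using R by (rule measure_algebraE)
  show "P \<sqsubseteq>\<^bsub>measure_algebra M\<^esub> R"
    if "P \<sqsubseteq>\<^bsub>measure_algebra M\<^esub> Q" "Q \<sqsubseteq>\<^bsub>measure_algebra M\<^esub> R"
    using that A B C null_diff_trans[of A M C B] by (simp add: measure_class_le_iff)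
next
  fix P assume "P \<in> carrier (measure_algebra M)"
  then obtain A where "A \<in> sets M" "P = measure_class M A" by (rule measure_algebraE)
  then show "P \<sqsubseteq>\<^bsub>measure_algebra M\<^esub> P" by (simp add: measure_class_le_iff)
qed (auto simp: measure_algebra_def)

lemma measure_algebra_least:
  assumes A: "A \<in> sets M" and B: "B \<in> sets M"
  shows "least (measure_algebra M) (measure_class M (A \<union> B))
    (Upper (measure_algebra M) {measure_class M A, measure_class M B})"
proof (rule least_UpperI)
  fix P assume P: "P \<in> Upper (measure_algebra M) {measure_class M A, measure_class M B}"
  then have "P \<in> carrier (measure_algebra M)" by (auto simp: Upper_def)
  then obtain C where C: "C \<in> sets M" "P = measure_class M C" by (rule measure_algebraE)
  have "A - C \<in> null_sets M" "B - C \<in> null_sets M"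
    using P A B C measure_class_carrier[OF A] measure_class_carrier[OF B]
    by (auto simp: Upper_def simp flip: measure_class_le_iff)
  then have "(A \<union> B) - C \<in> null_sets M"
    by (simp add: Un_Diff null_sets.Un)
  then show "measure_class M (A \<union> B) \<sqsubseteq>\<^bsub>measure_algebra M\<^esub> P"
    using A B C by (simp add: measure_class_le_iff)
next
  fix P assume "P \<in> {measure_class M A, measure_class M B}"
  then show "P \<sqsubseteq>\<^bsub>measure_algebra M\<^esub> measure_class M (A \<union> B)"
    using A B by (auto simp: measure_class_le_iff intro: null_diff_subset)
qed (use A B in \<open>auto intro!: measure_class_carrier\<close>)

lemma measure_algebra_greatest:
  assumes A: "A \<in> sets M" and B: "B \<in> sets M"
  shows "greatest (measure_algebra M) (measure_class M (A \<inter> B))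
    (Lower (measure_algebra M) {measure_class M A, measure_class M B})"
proof (rule greatest_LowerI)
  fix P assume P: "P \<in> Lower (measure_algebra M) {measure_class M A, measure_class M B}"
  then have "P \<in> carrier (measure_algebra M)" by (auto simp: Lower_def)
  then obtain C where C: "C \<in> sets M" "P = measure_class M C" by (rule measure_algebraE)
  have "C - A \<in> null_sets M" "C - B \<in> null_sets M"
    using P A B C measure_class_carrier[OF A] measure_class_carrier[OF B]
    by (auto simp: Lower_def simp flip: measure_class_le_iff)
  then have "C - (A \<inter> B) \<in> null_sets M"
    by (simp add: Diff_Int null_sets.Un)
  then show "P \<sqsubseteq>\<^bsub>measure_algebra M\<^esub> measure_class M (A \<inter> B)"
    using A B C by (simp add: measure_class_le_iff)
next
  fix P assume "P \<in> {measure_class M A, measure_class M B}"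
  then show "measure_class M (A \<inter> B) \<sqsubseteq>\<^bsub>measure_algebra M\<^esub> P"
    using A B by (auto simp: measure_class_le_iff intro: null_diff_subset)
qed (use A B in \<open>auto intro!: measure_class_carrier\<close>)

lemma measure_algebra_top:
  "greatest (measure_algebra M) (measure_class M (space M)) (carrier (measure_algebra M))"
  unfolding greatest_def
proof (intro conjI ballI)
  fix P assume "P \<in> carrier (measure_algebra M)"
  then obtain A where A: "A \<in> sets M" "P = measure_class M A" by (rule measure_algebraE)
  then show "P \<sqsubseteq>\<^bsub>measure_algebra M\<^esub> measure_class M (space M)"
    using A by (simp add: measure_class_le_iff null_diff_subset sets.sets_into_space)
qed (auto intro: measure_class_carrier)

lemma measure_algebra_bottom:
  "least (measure_algebra M) (measure_class M {}) (carrier (measure_algebra M))"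
  unfolding least_def
proof (intro conjI ballI)
  fix P assume "P \<in> carrier (measure_algebra M)"
  then obtain A where A: "A \<in> sets M" "P = measure_class M A" by (rule measure_algebraE)
  then show "measure_class M {} \<sqsubseteq>\<^bsub>measure_algebra M\<^esub> P"
    using A by (simp add: measure_class_le_iff)
qed (auto intro: measure_class_carrier)

text \<open>
  For a general measure the order \<^term>\<open>measure_algebra M\<close> need not be complete. Completeness is
  therefore a hypothesis here, and joins and meets of two classes are computed on representatives.
\<close>
locale complete_measure_algebra = complete_lattice "measure_algebra M" for M :: "'a measure"
begin

lemma join_class:
  "\<lbrakk>A \<in> sets M; B \<in> sets M\<rbrakk> \<Longrightarrow>
    measure_class M A \<squnion>\<^bsub>measure_algebra M\<^esub> measure_class M B = measure_class M (A \<union> B)"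
  unfolding join_def by (intro sup_eqI measure_algebra_least)

lemma meet_class:
  "\<lbrakk>A \<in> sets M; B \<in> sets M\<rbrakk> \<Longrightarrow>
    measure_class M A \<sqinter>\<^bsub>measure_algebra M\<^esub> measure_class M B = measure_class M (A \<inter> B)"
  unfolding meet_def by (intro inf_eqI measure_algebra_greatest)

lemma top_class: "\<top>\<^bsub>measure_algebra M\<^esub> = measure_class M (space M)"
  using greatest_unique[OF top_greatest measure_algebra_top] .

lemma bottom_class: "\<bottom>\<^bsub>measure_algebra M\<^esub> = measure_class M {}"
  using least_unique[OF bottom_least measure_algebra_bottom] .

lemma complete_boolean_algebra: "complete_boolean_algebra (measure_algebra M)"
proof unfold_locales
  fix P Q R
  assume "P \<in> carrier (measure_algebra M)" "Q \<in> carrier (measure_algebra M)"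
    "R \<in> carrier (measure_algebra M)"
  then obtain A B C where "A \<in> sets M" "P = measure_class M A" "B \<in> sets M" "Q = measure_class M B"
    "C \<in> sets M" "R = measure_class M C"
    by (metis measure_algebraE)
  then show "P \<sqinter>\<^bsub>measure_algebra M\<^esub> (Q \<squnion>\<^bsub>measure_algebra M\<^esub> R) =
    P \<sqinter>\<^bsub>measure_algebra M\<^esub> Q \<squnion>\<^bsub>measure_algebra M\<^esub> (P \<sqinter>\<^bsub>measure_algebra M\<^esub> R)"
    by (simp add: join_class meet_class Int_Un_distrib)
next
  fix P assume "P \<in> carrier (measure_algebra M)"
  then obtain A where A: "A \<in> sets M" "P = measure_class M A" by (rule measure_algebraE)
  have "P \<sqinter>\<^bsub>measure_algebra M\<^esub> measure_class M (space M - A) = \<bottom>\<^bsub>measure_algebra M\<^esub>"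
    using A by (simp add: meet_class bottom_class)
  moreover have "A \<union> (space M - A) = space M" using A sets.sets_into_space by auto
  then have "P \<squnion>\<^bsub>measure_algebra M\<^esub> measure_class M (space M - A) = \<top>\<^bsub>measure_algebra M\<^esub>"
    using A by (simp add: join_class top_class)
  ultimately show "\<exists>Q\<in>carrier (measure_algebra M).
      P \<sqinter>\<^bsub>measure_algebra M\<^esub> Q = \<bottom>\<^bsub>measure_algebra M\<^esub> \<and>
      P \<squnion>\<^bsub>measure_algebra M\<^esub> Q = \<top>\<^bsub>measure_algebra M\<^esub>"
    using A measure_class_carrier[of "space M - A" M] by blast
qed

end

section \<open>Ideals of compact sets\<close>

lemma ennreal_positive_lower_bound:
  fixes \<epsilon> :: ennreal
  assumes "\<epsilon> > 0" obtains e :: real where "e > 0" "ennreal e \<le> \<epsilon>"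
proof (cases \<epsilon>)
  case (real r)
  then show ?thesis using assms that[of r] by simp
next
  case top
  then show ?thesis using that[of 1] by simp
qed

context radon_measure
begin

lemma compactin_closed: "compactin X C \<Longrightarrow> closedin X C"
  using Hausdorff compactin_imp_closedin by blast

lemma compactin_Int: "\<lbrakk>compactin X C; compactin X D\<rbrakk> \<Longrightarrow> compactin X (C \<inter> D)"
  using closed_Int_compactin[OF compactin_closed] by blast

lemma compact_diff_measurable:
  "\<lbrakk>compactin X C; E \<in> sets M\<rbrakk> \<Longrightarrow> C - E \<in> sets M"
  using compact_measurable by blast

text \<open>
  Inner regularity is mostly used in this form: positive measure is always witnessed by a compact
  subset.
\<close>
lemma null_set_if_no_compact:
  assumes E: "E \<in> sets M"
    and C: "\<And>C. \<lbrakk>compactin X C; C \<subseteq> E\<rbrakk> \<Longrightarrow> emeasure M C = 0"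
  shows "E \<in> null_sets M"
proof -
  have "emeasure M E \<le> 0"
    unfolding inner_regular[OF E] using C by (intro SUP_least) auto
  then show ?thesis using E by auto
qed

lemma compact_lattice_sup:
  assumes T: "finite T" "\<And>C. C \<in> T \<Longrightarrow> compactin X C"
  shows "\<Squnion>\<^bsub>compact_lattice X\<^esub>T = \<Union>T"
proof -
  interpret lattice "compact_lattice X" by (rule lattice_compact_lattice)
  have "compactin X (\<Union>T)" using T by (rule compactin_Union)
  then have *: "least (compact_lattice X) (\<Union>T) (Upper (compact_lattice X) T)"
    using T by (auto simp: least_def Upper_def compact_lattice_def)
  then show ?thesis
    unfolding sup_def using least_unique by (metis someI)
qed

text \<open>
  For compact sets, being almost exhausted by finitely many members says that their union leaves
  out a set of small measure. Real bounds replace the extended ones so that they can be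
  halved and added later on.
\<close>
lemma inner_cover_compact_iff:
  assumes C: "compactin X C"
  shows "inner_cover (compact_lattice X) (emeasure M) C S \<longleftrightarrow>
    (\<forall>D\<in>S. compactin X D \<and> D \<subseteq> C) \<and>
    (\<forall>e::real. e > 0 \<longrightarrow> (\<exists>T. finite T \<and> T \<subseteq> S \<and> emeasure M (C - \<Union>T) < ennreal e))"
proof (cases "\<forall>D\<in>S. compactin X D \<and> D \<subseteq> C")
  case True
  have diff: "emeasure M C - emeasure M (\<Squnion>\<^bsub>compact_lattice X\<^esub>T) = emeasure M (C - \<Union>T)"
    if T: "finite T" "T \<subseteq> S" for T
  proof -
    have UT: "compactin X (\<Union>T)" "\<Union>T \<subseteq> C"
      using T True by (auto intro!: compactin_Union)
    then show ?thesis
      using emeasure_Diff[of M "\<Union>T" C] compact_measurable[OF UT(1)] compact_measurable[OF C]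
        compact_finite[OF UT(1)] compact_lattice_sup[of T] T True
      by (auto simp: subset_iff)
  qed
  have "(\<forall>\<epsilon>>0. \<exists>T. finite T \<and> T \<subseteq> S \<and> emeasure M (C - \<Union>T) < \<epsilon>) \<longleftrightarrow>
    (\<forall>e::real. e > 0 \<longrightarrow> (\<exists>T. finite T \<and> T \<subseteq> S \<and> emeasure M (C - \<Union>T) < ennreal e))"
    (is "?L \<longleftrightarrow> ?R")
  proof
    assume ?L
    then show ?R using ennreal_less_zero_iff by blast
  next
    assume R: ?R
    show ?L
    proof (intro allI impI)
      fix \<epsilon> :: ennreal assume "\<epsilon> > 0"
      then obtain e :: real where "e > 0" "ennreal e \<le> \<epsilon>"
        by (rule ennreal_positive_lower_bound)
      then show "\<exists>T. finite T \<and> T \<subseteq> S \<and> emeasure M (C - \<Union>T) < \<epsilon>"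
        using R by (meson order_less_le_trans)
    qed
  qed
  moreover have "S \<subseteq> {D \<in> carrier (compact_lattice X). D \<sqsubseteq>\<^bsub>compact_lattice X\<^esub> C}"
    using True by (auto simp: compact_lattice_def)
  moreover have "(\<forall>\<epsilon>>0. \<exists>T. finite T \<and> T \<subseteq> S \<and>
      emeasure M C - emeasure M (\<Squnion>\<^bsub>compact_lattice X\<^esub>T) < \<epsilon>) \<longleftrightarrow>
    (\<forall>\<epsilon>>0. \<exists>T. finite T \<and> T \<subseteq> S \<and> emeasure M (C - \<Union>T) < \<epsilon>)"
    by (intro iff_allI imp_cong iff_exI refl) (auto simp: diff)
  ultimately show ?thesis
    unfolding inner_cover_def using True by simp
next
  case False
  then show ?thesis by (auto simp: inner_cover_def compact_lattice_def)
qed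

lemma valuation_ideal_compact_iff:
  "valuation_ideal (compact_lattice X) (emeasure M) U \<longleftrightarrow>
    (\<forall>C\<in>U. compactin X C) \<and>
    (\<forall>C\<in>U. \<forall>D. compactin X D \<longrightarrow> D \<subseteq> C \<longrightarrow> D \<in> U) \<and>
    (\<forall>C S. compactin X C \<longrightarrow> S \<subseteq> U \<longrightarrow> (\<forall>D\<in>S. D \<subseteq> C) \<longrightarrow>
      (\<forall>e::real. e > 0 \<longrightarrow> (\<exists>T. finite T \<and> T \<subseteq> S \<and> emeasure M (C - \<Union>T) < ennreal e)) \<longrightarrow> C \<in> U)"
proof (cases "\<forall>C\<in>U. compactin X C")
  case True
  have "(\<forall>C\<in>carrier (compact_lattice X). \<forall>S.
      S \<subseteq> U \<and> inner_cover (compact_lattice X) (emeasure M) C S \<longrightarrow> C \<in> U) \<longleftrightarrow>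
    (\<forall>C S. compactin X C \<longrightarrow> S \<subseteq> U \<longrightarrow> (\<forall>D\<in>S. D \<subseteq> C) \<longrightarrow>
      (\<forall>e::real. e > 0 \<longrightarrow> (\<exists>T. finite T \<and> T \<subseteq> S \<and> emeasure M (C - \<Union>T) < ennreal e)) \<longrightarrow> C \<in> U)"
    (is "?L \<longleftrightarrow> ?R")
  proof
    assume L: ?L
    show ?R
    proof (intro allI impI)
      fix C S
      assume C: "compactin X C" and S: "S \<subseteq> U" and "\<forall>D\<in>S. D \<subseteq> C"
        "\<forall>e::real. e > 0 \<longrightarrow> (\<exists>T. finite T \<and> T \<subseteq> S \<and> emeasure M (C - \<Union>T) < ennreal e)"
      then have "inner_cover (compact_lattice X) (emeasure M) C S"
        using True by (auto simp: inner_cover_compact_iff[OF C])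
      then show "C \<in> U" using L C S by (auto simp: compact_lattice_def)
    qed
  next
    assume R: ?R
    show ?L
    proof (intro ballI allI impI)
      fix C S
      assume "C \<in> carrier (compact_lattice X)"
        and S: "S \<subseteq> U \<and> inner_cover (compact_lattice X) (emeasure M) C S"
      then have C: "compactin X C" by (simp add: compact_lattice_def)
      have "\<forall>D\<in>S. D \<subseteq> C"
        "\<forall>e::real. e > 0 \<longrightarrow> (\<exists>T. finite T \<and> T \<subseteq> S \<and> emeasure M (C - \<Union>T) < ennreal e)"
        using S inner_cover_compact_iff[OF C] by auto
      then show "C \<in> U"
        using R[THEN spec, THEN spec, of C S] C S by simp
    qed
  qed
  then show ?thesis
    using True by (auto simp: valuation_ideal_def compact_lattice_def)
next
  case False
  then show ?thesis by (auto simp: valuation_ideal_def compact_lattice_def)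
qed

definition compact_ideal :: "'a set set \<Rightarrow> bool" where
  "compact_ideal U \<longleftrightarrow> valuation_ideal (compact_lattice X) (emeasure M) U"

lemma compact_idealI:
  assumes "\<And>C. C \<in> U \<Longrightarrow> compactin X C"
    and "\<And>C D. \<lbrakk>C \<in> U; compactin X D; D \<subseteq> C\<rbrakk> \<Longrightarrow> D \<in> U"
    and "\<And>C S. \<lbrakk>compactin X C; S \<subseteq> U; \<And>D. D \<in> S \<Longrightarrow> D \<subseteq> C;
      \<And>e::real. e > 0 \<Longrightarrow> \<exists>T. finite T \<and> T \<subseteq> S \<and> emeasure M (C - \<Union>T) < ennreal e\<rbrakk> \<Longrightarrow> C \<in> U"
  shows "compact_ideal U"
  unfolding compact_ideal_def valuation_ideal_compact_iff
proof (intro conjI ballI allI impI)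
  fix C S
  assume "compactin X C" "S \<subseteq> U" "\<forall>D\<in>S. D \<subseteq> C"
    "\<forall>e::real. e > 0 \<longrightarrow> (\<exists>T. finite T \<and> T \<subseteq> S \<and> emeasure M (C - \<Union>T) < ennreal e)"
  then show "C \<in> U" using assms(3)[of C S] by simp
qed (fact assms)+

lemma compact_ideal_compact: "\<lbrakk>compact_ideal U; C \<in> U\<rbrakk> \<Longrightarrow> compactin X C"
  unfolding compact_ideal_def valuation_ideal_compact_iff by (elim conjE bspec)

lemma compact_ideal_subset:
  assumes "compact_ideal U" "C \<in> U" "compactin X D" "D \<subseteq> C"
  shows "D \<in> U"
proof -
  have "\<forall>C\<in>U. \<forall>D. compactin X D \<longrightarrow> D \<subseteq> C \<longrightarrow> D \<in> U"
    using assms(1) unfolding compact_ideal_def valuation_ideal_compact_iff by (elim conjE)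
  then show ?thesis using assms(2-) by simp
qed

lemma compact_ideal_cover:
  assumes "compact_ideal U" "compactin X C" "S \<subseteq> U" "\<And>D. D \<in> S \<Longrightarrow> D \<subseteq> C"
    "\<And>e::real. e > 0 \<Longrightarrow> \<exists>T. finite T \<and> T \<subseteq> S \<and> emeasure M (C - \<Union>T) < ennreal e"
  shows "C \<in> U"
proof -
  have "\<forall>C S. compactin X C \<longrightarrow> S \<subseteq> U \<longrightarrow> (\<forall>D\<in>S. D \<subseteq> C) \<longrightarrow>
      (\<forall>e::real. e > 0 \<longrightarrow> (\<exists>T. finite T \<and> T \<subseteq> S \<and> emeasure M (C - \<Union>T) < ennreal e)) \<longrightarrow> C \<in> U"
    using assms(1) unfolding compact_ideal_def valuation_ideal_compact_iff by (elim conjE)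
  from this[THEN spec, THEN spec, of C S] show ?thesis using assms(2-) by simp
qed

text \<open>
  The ideal that corresponds to a measurable set. Asking for \<open>C - E\<close> to be null instead of empty
  makes it depend on the class of \<open>E\<close> only and makes it closed under inner covers.
\<close>
definition compact_part :: "'a set \<Rightarrow> 'a set set" where
  "compact_part E = {C. compactin X C \<and> C - E \<in> null_sets M}"

text \<open>
  If finitely many members of the ideal cover \<open>C\<close> up to \<open>e\<close>, then, since these members lie in \<open>E\<close>
  up to a null set, \<open>C\<close> lies in \<open>E\<close> up to \<open>e\<close>.
\<close>
lemma compact_ideal_compact_part:
  assumes E: "E \<in> sets M"
  shows "compact_ideal (compact_part E)"
proof (rule compact_idealI)
  fix C D assume "C \<in> compact_part E" and D: "compactin X D" "D \<subseteq> C"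
  then have "C - E \<in> null_sets M" by (simp add: compact_part_def)
  moreover have "D - E \<in> sets M" using D E by (rule_tac compact_diff_measurable)
  ultimately show "D \<in> compact_part E"
    using D null_sets_subset[of "C - E" M "D - E"] by (auto simp: compact_part_def)
next
  fix C S
  assume C: "compactin X C" and S: "S \<subseteq> compact_part E" "\<And>D. D \<in> S \<Longrightarrow> D \<subseteq> C"
    and cover: "\<And>e::real. e > 0 \<Longrightarrow> \<exists>T. finite T \<and> T \<subseteq> S \<and> emeasure M (C - \<Union>T) < ennreal e"
  have approx: "emeasure M (C - E) \<le> 0 + ennreal e" if "e > 0" for e :: real
  proof -
    obtain T where T: "finite T" "T \<subseteq> S" "emeasure M (C - \<Union>T) < ennreal e"
      using cover[OF \<open>e > 0\<close>] by blast
    have UT: "\<Union>T \<in> sets M"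
      using T S by (intro sets.finite_Union) (auto simp: compact_part_def intro: compact_measurable)
    have "(\<Union>D\<in>T. D - E) \<in> null_sets M"
      using T S by (intro null_sets_UN') (auto simp: compact_part_def countable_finite)
    then have null: "\<Union>T - E \<in> null_sets M" by simp
    have CT: "C - \<Union>T \<in> sets M" using C UT by (rule compact_diff_measurable)
    have "emeasure M (C - E) \<le> emeasure M ((C - \<Union>T) \<union> (\<Union>T - E))"
      using CT null by (intro emeasure_mono) auto
    also have "\<dots> = emeasure M (C - \<Union>T)"
      using CT null by (rule emeasure_Un_null_set)
    finally have "emeasure M (C - E) \<le> emeasure M (C - \<Union>T)" .
    then show ?thesis using T by simp
  qed
  have "emeasure M (C - E) \<le> 0" by (rule ennreal_le_epsilon) (rule approx)
  then show "C \<in> compact_part E"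
    using C E by (auto simp: compact_part_def compact_diff_measurable)
qed (auto simp: compact_part_def)

text \<open>
  By inner regularity a non-null difference \<open>A - B\<close> contains a compact set of positive measure,
  which belongs to the ideal of \<open>A\<close> but not to that of \<open>B\<close>. So the ideal determines the class.
\<close>
lemma compact_part_subset_iff:
  assumes A: "A \<in> sets M" and B: "B \<in> sets M"
  shows "compact_part A \<subseteq> compact_part B \<longleftrightarrow> A - B \<in> null_sets M"
proof
  assume sub: "compact_part A \<subseteq> compact_part B"
  show "A - B \<in> null_sets M"
  proof (rule null_set_if_no_compact)
    fix C assume C: "compactin X C" "C \<subseteq> A - B"
    then have "C \<in> compact_part A" by (auto simp: compact_part_def intro: null_diff_subset)
    then have "C - B \<in> null_sets M" using sub by (auto simp: compact_part_def)
    moreover have "C - B = C" using C by auto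
    ultimately show "emeasure M C = 0" by auto
  qed (use A B in auto)
next
  assume "A - B \<in> null_sets M"
  then show "compact_part A \<subseteq> compact_part B"
    using B by (auto simp: compact_part_def intro: null_diff_trans compact_measurable)
qed

lemma inner_measure_compact_part:
  assumes E: "E \<in> sets M"
  shows "inner_measure (emeasure M) (compact_part E) = emeasure M E"
  unfolding inner_measure_def
proof (rule antisym)
  show "(SUP C\<in>compact_part E. emeasure M C) \<le> emeasure M E"
  proof (rule SUP_least)
    fix C assume "C \<in> compact_part E"
    then have C: "C - E \<in> null_sets M" "C \<in> sets M"
      by (auto simp: compact_part_def compact_measurable)
    then have "emeasure M C \<le> emeasure M (E \<union> (C - E))"
      using E by (intro emeasure_mono) auto
    also have "\<dots> = emeasure M E" using C E by (intro emeasure_Un_null_set) auto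
    finally show "emeasure M C \<le> emeasure M E" .
  qed
  show "emeasure M E \<le> (SUP C\<in>compact_part E. emeasure M C)"
    unfolding inner_regular[OF E]
    by (intro SUP_subset_mono) (auto simp: compact_part_def intro: null_diff_subset)
qed

section \<open>Every ideal comes from a measurable set\<close>

text \<open>
  The essential union of a possibly uncountable ideal has to be realised by an honest measurable
  set. The union of an arbitrary disjoint family of compact sets need not be measurable, but it is
  if all members are self-supporting, because an open set of finite measure then meets only
  countably many of them.
\<close>
definition self_supporting :: "'a set \<Rightarrow> bool" where
  "self_supporting K \<longleftrightarrow> compactin X K \<and> K \<noteq> {} \<and>
    (\<forall>V. openin X V \<longrightarrow> V \<inter> K \<noteq> {} \<longrightarrow> emeasure M (V \<inter> K) > 0)"

text \<open>
  Removing from \<open>C\<close> all open sets that meet it in a null set removes a null set in total: a compact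
  subset of the removed part is covered by finitely many of these open sets. What is left is the
  support of the measure on \<open>C\<close>.
\<close>
lemma self_supporting_subset:
  assumes C: "compactin X C" and pos: "emeasure M C > 0"
  obtains K where "K \<subseteq> C" "self_supporting K"
proof -
  define \<V> where "\<V> = {V. openin X V \<and> V \<inter> C \<in> null_sets M}"
  define K where "K = C - \<Union>\<V>"
  have V: "openin X (\<Union>\<V>)" by (auto simp: \<V>_def)
  have "closedin X (topspace X - \<Union>\<V>)" using V by auto
  moreover have "K = (topspace X - \<Union>\<V>) \<inter> C"
    using compactin_subset_topspace[OF C] by (auto simp: K_def)
  ultimately have K: "compactin X K" using C closed_Int_compactin by metis
  have null: "C - K \<in> null_sets M"
  proof (rule null_set_if_no_compact)
    show "C - K \<in> sets M" using C compact_measurable[OF K] by (rule compact_diff_measurable)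
    fix D assume D: "compactin X D" "D \<subseteq> C - K"
    then have "D \<subseteq> \<Union>\<V>" by (auto simp: K_def)
    then obtain \<F> where F: "finite \<F>" "\<F> \<subseteq> \<V>" "D \<subseteq> \<Union>\<F>"
      using compactinD[OF D(1), of \<V>] by (auto simp: \<V>_def)
    have "(\<Union>V\<in>\<F>. V \<inter> C) \<in> null_sets M"
      using F by (intro null_sets_UN') (auto simp: \<V>_def countable_finite)
    moreover have "D \<subseteq> (\<Union>V\<in>\<F>. V \<inter> C)" using D F by auto
    ultimately have "D \<in> null_sets M"
      using compact_measurable[OF D(1)] null_sets_subset by blast
    then show "emeasure M D = 0" by auto
  qed
  have "emeasure M (V \<inter> K) > 0" if "openin X V" "V \<inter> K \<noteq> {}" for V
  proof (rule ccontr)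
    assume "\<not> ?thesis"
    then have "V \<inter> K \<in> null_sets M"
      using that K open_measurable compact_measurable by auto
    then have "(V \<inter> K) \<union> (C - K) \<in> null_sets M" using null by (rule null_sets.Un)
    moreover have "V \<inter> C \<in> sets M" using that C open_measurable compact_measurable by auto
    ultimately have "V \<inter> C \<in> null_sets M"
      by (rule null_sets_subset) auto
    then have "V \<in> \<V>" using that by (simp add: \<V>_def)
    then show False using that by (auto simp: K_def)
  qed
  moreover have "K \<noteq> {}" using null pos by auto
  ultimately have "self_supporting K" using K by (simp add: self_supporting_def)
  then show ?thesis using that[of K] by (auto simp: K_def)
qed

lemma compact_finite_open_neighbourhood:
  assumes C: "compactin X C"
  obtains G where "openin X G" "C \<subseteq> G" "emeasure M G < \<infinity>"
proof -
  define \<U> where "\<U> = {U. openin X U \<and> emeasure M U < \<infinity>}"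
  have "C \<subseteq> \<Union>\<U>"
    using locally_finite compactin_subset_topspace[OF C] unfolding \<U>_def by fast
  then obtain \<F> where F: "finite \<F>" "\<F> \<subseteq> \<U>" "C \<subseteq> \<Union>\<F>"
    using compactinD[OF C, of \<U>] by (auto simp: \<U>_def)
  have m: "U \<in> sets M" if "U \<in> \<F>" for U using that F open_measurable by (auto simp: \<U>_def)
  have "emeasure M (\<Union>\<F>) \<le> (\<Sum>U\<in>\<F>. emeasure M U)"
    using emeasure_subadditive_finite[of \<F> "\<lambda>U. U" M] F m by auto
  also have "\<dots> < \<infinity>" using F by (auto simp: \<U>_def)
  finally show ?thesis using F that[of "\<Union>\<F>"] by (auto simp: \<U>_def)
qed

text \<open>
  The traces on \<open>G\<close> of the members that meet it are disjoint and of positive measure, with finite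
  total mass; a summable family has only countably many nonzero terms.
\<close>
lemma countable_disjoint_meeting_open:
  assumes K: "\<And>K. K \<in> \<K> \<Longrightarrow> self_supporting K" and disj: "disjoint \<K>"
    and G: "openin X G" "emeasure M G < \<infinity>"
  shows "countable {K \<in> \<K>. G \<inter> K \<noteq> {}}"
proof -
  have meas: "G \<inter> K \<in> sets M" "emeasure M (G \<inter> K) \<noteq> \<infinity>" if "K \<in> \<K>" for K
  proof -
    show "G \<inter> K \<in> sets M"
      using K[OF that] G open_measurable compact_measurable by (auto simp: self_supporting_def)
    then have "emeasure M (G \<inter> K) \<le> emeasure M G"
      using G open_measurable by (intro emeasure_mono) auto
    then show "emeasure M (G \<inter> K) \<noteq> \<infinity>" using G by (auto simp: top_unique)
  qed
  have "(\<lambda>K. measure M (G \<inter> K)) summable_on \<K>"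
  proof (rule nonneg_bdd_above_summable_on)
    have "(\<Sum>K\<in>\<F>. measure M (G \<inter> K)) \<le> measure M G" if F: "\<F> \<subseteq> \<K>" "finite \<F>" for \<F>
    proof -
      have "disjoint_family_on (\<lambda>K. G \<inter> K) \<F>"
        using disj F by (auto simp: disjoint_family_on_def disjoint_def)
      then have "(\<Sum>K\<in>\<F>. measure M (G \<inter> K)) = measure M (\<Union>K\<in>\<F>. G \<inter> K)"
        using F meas by (intro measure_finite_Union[symmetric]) auto
      also have "\<dots> \<le> measure M G"
      proof (rule measure_mono_fmeasurable)
        show "(\<Union>K\<in>\<F>. G \<inter> K) \<in> sets M" using F meas by (intro sets.finite_UN) auto
        show "G \<in> fmeasurable M" using G open_measurable by (auto simp: fmeasurable_def)
      qed auto
      finally show ?thesis .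
    qed
    then show "bdd_above (sum (\<lambda>K. measure M (G \<inter> K)) ` {F. F \<subseteq> \<K> \<and> finite F})"
      by (auto intro!: bdd_aboveI[of _ "measure M G"])
  qed simp
  then have "countable {K \<in> \<K>. measure M (G \<inter> K) \<noteq> 0}"
    by (rule summable_countable_real)
  moreover have "measure M (G \<inter> K) \<noteq> 0" if "K \<in> \<K>" "G \<inter> K \<noteq> {}" for K
  proof -
    have "emeasure M (G \<inter> K) > 0" using K[OF that(1)] that(2) G by (auto simp: self_supporting_def)
    then show ?thesis using meas[OF that(1)] by (auto simp: measure_def enn2real_eq_0_iff)
  qed
  ultimately show ?thesis by (rule_tac countable_subset[rotated]) auto
qed

lemma countable_disjoint_meeting_compact:
  assumes "\<And>K. K \<in> \<K> \<Longrightarrow> self_supporting K" "disjoint \<K>" and C: "compactin X C"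
  shows "countable {K \<in> \<K>. C \<inter> K \<noteq> {}}"
proof -
  obtain G where G: "openin X G" "C \<subseteq> G" "emeasure M G < \<infinity>"
    using compact_finite_open_neighbourhood[OF C] .
  have "countable {K \<in> \<K>. G \<inter> K \<noteq> {}}"
    using assms(1,2) G(1,3) by (rule countable_disjoint_meeting_open)
  then show ?thesis
    by (rule countable_subset[rotated]) (use G(2) in auto)
qed

lemma finite_measure_compact_exhaustion:
  assumes F: "F \<in> sets M" "emeasure M F < \<infinity>"
  obtains C :: "nat \<Rightarrow> 'a set" where "\<And>n. compactin X (C n)" "F - (\<Union>n. C n) \<in> null_sets M"
    "\<And>n. C n \<subseteq> F"
proof -
  have ne: "{C. C \<subseteq> F \<and> compactin X C} \<noteq> {}" by auto
  obtain f :: "nat \<Rightarrow> ennreal" where f: "range f \<subseteq> emeasure M ` {C. C \<subseteq> F \<and> compactin X C}"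
    "emeasure M F = (SUP n. f n)"
    using ennreal_SUP_countable_SUP[OF ne, of "emeasure M"] inner_regular[OF F(1)] by auto
  have "\<exists>C. C \<subseteq> F \<and> compactin X C \<and> f n = emeasure M C" for n
    using f(1) by blast
  then obtain C where C: "\<And>n. C n \<subseteq> F" "\<And>n. compactin X (C n)" "\<And>n. f n = emeasure M (C n)"
    by metis
  have UC: "(\<Union>n. C n) \<in> sets M" using C compact_measurable by blast
  have sub: "(\<Union>n. C n) \<subseteq> F" using C by auto
  have "emeasure M F \<le> emeasure M (\<Union>n. C n)"
    unfolding f(2) C(3) by (intro SUP_least emeasure_mono UC) auto
  moreover have "emeasure M (\<Union>n. C n) \<le> emeasure M F"
    using sub F by (intro emeasure_mono) auto
  ultimately have eq: "emeasure M (\<Union>n. C n) = emeasure M F" by simp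
  then have "emeasure M (F - (\<Union>n. C n)) = 0"
    using emeasure_Diff[of M "\<Union>n. C n" F] UC F sub by auto
  then show ?thesis using that[of C] C UC F by auto
qed

text \<open>
  A set of finite measure is a countable union of compact sets up to a null set, and completeness
  takes care of the remainder, so local determinedness needs testing on compact sets only.
\<close>
lemma measurable_if_Int_compact:
  assumes E: "E \<subseteq> topspace X" and C: "\<And>C. compactin X C \<Longrightarrow> E \<inter> C \<in> sets M"
  shows "E \<in> sets M"
proof (rule locally_determined[OF E])
  fix F assume "F \<in> sets M" "emeasure M F < \<infinity>"
  then obtain D :: "nat \<Rightarrow> 'a set" where D: "\<And>n. compactin X (D n)"
    "F - (\<Union>n. D n) \<in> null_sets M" "\<And>n. D n \<subseteq> F"
    using finite_measure_compact_exhaustion by blast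
  have "E \<inter> (F - (\<Union>n. D n)) \<in> sets M"
    using D(2) by (rule complete[rotated]) auto
  moreover have "(\<Union>n. E \<inter> D n) \<in> sets M" using C D(1) by blast
  moreover have "E \<inter> F = (\<Union>n. E \<inter> D n) \<union> (E \<inter> (F - (\<Union>n. D n)))" using D(3) by auto
  ultimately show "E \<inter> F \<in> sets M" by (metis sets.Un)
qed

lemma Union_self_supporting_measurable:
  assumes K: "\<And>K. K \<in> \<K> \<Longrightarrow> self_supporting K" and disj: "disjoint \<K>"
  shows "\<Union>\<K> \<in> sets M"
proof (rule measurable_if_Int_compact)
  show "\<Union>\<K> \<subseteq> topspace X"
    using K compactin_subset_topspace by (fastforce simp: self_supporting_def)
  fix C assume C: "compactin X C"
  have "\<Union>\<K> \<inter> C = (\<Union>K\<in>{K \<in> \<K>. C \<inter> K \<noteq> {}}. K \<inter> C)" by auto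
  also have "\<dots> \<in> sets M"
    using K C compact_measurable
    by (intro sets.countable_UN'[OF countable_disjoint_meeting_compact[OF K disj C]])
       (auto simp: self_supporting_def)
  finally show "\<Union>\<K> \<inter> C \<in> sets M" .
qed

lemma maximal_disjoint_self_supporting:
  obtains \<K> where "\<K> \<subseteq> U" "\<And>K. K \<in> \<K> \<Longrightarrow> self_supporting K" "disjoint \<K>"
    "\<And>K. \<lbrakk>K \<in> U; self_supporting K; K \<inter> \<Union>\<K> = {}\<rbrakk> \<Longrightarrow> False"
proof -
  define \<A> where "\<A> = {\<K>. \<K> \<subseteq> U \<and> (\<forall>K\<in>\<K>. self_supporting K) \<and> disjoint \<K>}"
  have "\<Union>\<C> \<in> \<A>" if "subset.chain \<A> \<C>" for \<C>
  proof -
    have C: "\<C> \<subseteq> \<A>" "\<And>x y. x \<in> \<C> \<Longrightarrow> y \<in> \<C> \<Longrightarrow> x \<subseteq> y \<or> y \<subseteq> x"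
      using that by (auto simp: subset_chain_def)
    have "K \<inter> L = {}" if KL: "K \<in> \<Union>\<C>" "L \<in> \<Union>\<C>" "K \<noteq> L" for K L
    proof -
      obtain x y where xy: "K \<in> x" "x \<in> \<C>" "L \<in> y" "y \<in> \<C>" using KL by auto
      then obtain z where "z \<in> \<C>" "K \<in> z" "L \<in> z" using C(2)[of x y] by auto
      moreover from this have "disjoint z" using C(1) by (auto simp: \<A>_def)
      ultimately show ?thesis using KL(3) by (auto simp: disjoint_def)
    qed
    then show ?thesis using C(1) by (auto simp: \<A>_def disjoint_def)
  qed
  then obtain \<K> where K: "\<K> \<in> \<A>" and max: "\<And>\<L>. \<lbrakk>\<L> \<in> \<A>; \<K> \<subseteq> \<L>\<rbrakk> \<Longrightarrow> \<L> = \<K>"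
    using subset_Zorn'[of \<A>] by blast
  have False if L: "L \<in> U" "self_supporting L" "L \<inter> \<Union>\<K> = {}" for L
  proof -
    have "insert L \<K> \<in> \<A>" using K L by (auto simp: \<A>_def disjoint_def)
    then have "L \<in> \<K>" using max[of "insert L \<K>"] by auto
    then show False using L by (auto simp: self_supporting_def)
  qed
  then show ?thesis using K that[of \<K>] by (auto simp: \<A>_def)
qed

text \<open>
  Let \<open>E\<close> be the union of a maximal disjoint family of self-supporting members of \<open>U\<close>. A member
  of \<open>U\<close> that is not contained in \<open>E\<close> up to a null set would contain a further self-supporting
  set disjoint from \<open>E\<close>, against maximality. Conversely, a compact \<open>C\<close> that is almost contained in
  \<open>E\<close> meets only countably many members of the family, and their traces on \<open>C\<close>, which belong to
  \<open>U\<close>, form an inner cover of \<open>C\<close>.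
\<close>
proposition compact_ideal_eq_compact_part:
  assumes U: "compact_ideal U"
  obtains E where "E \<in> sets M" "U = compact_part E"
proof -
  obtain \<K> where KU: "\<K> \<subseteq> U" and K: "\<And>K. K \<in> \<K> \<Longrightarrow> self_supporting K" and disj: "disjoint \<K>"
    and max: "\<And>K. \<lbrakk>K \<in> U; self_supporting K; K \<inter> \<Union>\<K> = {}\<rbrakk> \<Longrightarrow> False"
    using maximal_disjoint_self_supporting[of U] by metis
  define E where "E = \<Union>\<K>"
  have E: "E \<in> sets M" unfolding E_def using K disj by (rule Union_self_supporting_measurable)
  have "C \<in> compact_part E" if "C \<in> U" for C
  proof -
    have C: "compactin X C" using compact_ideal_compact[OF U that] .
    have "C - E \<in> null_sets M"
    proof (rule null_set_if_no_compact)
      show "C - E \<in> sets M" using C E by (rule compact_diff_measurable)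
      fix D assume D: "compactin X D" "D \<subseteq> C - E"
      show "emeasure M D = 0"
      proof (rule ccontr)
        assume "emeasure M D \<noteq> 0"
        then have "emeasure M D > 0" by (simp add: zero_less_iff_neq_zero)
        then obtain L where L: "L \<subseteq> D" "self_supporting L"
          using self_supporting_subset[OF D(1)] by metis
        then have "L \<in> U"
          using compact_ideal_subset[OF U that, of L] D by (auto simp: self_supporting_def)
        then show False using max[of L] L D by (auto simp: E_def)
      qed
    qed
    then show ?thesis using C by (simp add: compact_part_def)
  qed
  moreover have "C \<in> U" if "C \<in> compact_part E" for C
  proof -
    have C: "compactin X C" "C - E \<in> null_sets M" using that by (auto simp: compact_part_def)
    define \<L> where "\<L> = {K \<in> \<K>. C \<inter> K \<noteq> {}}"
    have L: "countable \<L>"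
      unfolding \<L>_def using K disj C(1) by (rule countable_disjoint_meeting_compact)
    define S where "S = (\<lambda>K. C \<inter> K) ` \<L>"
    have S: "compactin X D" "D \<in> U" if "D \<in> S" for D
    proof -
      obtain L where L: "L \<in> \<K>" "D = C \<inter> L" using \<open>D \<in> S\<close> by (auto simp: S_def \<L>_def)
      then show "compactin X D" using K C(1) compactin_Int by (auto simp: self_supporting_def)
      then show "D \<in> U" using compact_ideal_subset[OF U, of L D] L KU by auto
    qed
    have CS: "C - \<Union>S \<in> null_sets M"
    proof -
      have "C - \<Union>S = C - E" by (auto simp: S_def E_def \<L>_def)
      then show ?thesis using C(2) by simp
    qed
    show "C \<in> U"
    proof (rule compact_ideal_cover[OF U C(1), of S])
      show "S \<subseteq> U" using S by auto
      show "D \<subseteq> C" if "D \<in> S" for D using that by (auto simp: S_def)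
      fix e :: real assume e: "e > 0"
      show "\<exists>T. finite T \<and> T \<subseteq> S \<and> emeasure M (C - \<Union>T) < ennreal e"
      proof (cases "S = {}")
        case True
        then show ?thesis using CS e by (intro exI[of _ "{}"]) auto
      next
        case False
        have "countable S" using L by (simp add: S_def)
        then obtain s where s: "S = range (s :: nat \<Rightarrow> 'a set)"
          using False by (metis uncountable_def)
        \<comment> \<open>The remainders decrease to the null set \<open>C - \<Union>S\<close>, and \<open>C\<close> has finite measure.\<close>
        define R where "R n = C - (\<Union>i\<le>n. s i)" for n
        have sm: "s i \<in> sets M" for i using S s compact_measurable by auto
        have "(\<lambda>n. emeasure M (R n)) \<longlonglongrightarrow> emeasure M (\<Inter>n. R n)"
        proof (rule Lim_emeasure_decseq)
          show "range R \<subseteq> sets M"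
            using sm C(1) compact_measurable by (auto simp: R_def)
          show "decseq R" by (auto simp: R_def decseq_def)
          show "emeasure M (R n) \<noteq> \<infinity>" for n
            using emeasure_mono[of "R n" C M] compact_finite[OF C(1)] compact_measurable[OF C(1)]
            by (auto simp: R_def top_unique)
        qed
        moreover have "(\<Inter>n. R n) = C - \<Union>S" by (auto simp: R_def s)
        ultimately have "(\<lambda>n. emeasure M (R n)) \<longlonglongrightarrow> 0" using CS by auto
        then have "eventually (\<lambda>n. emeasure M (R n) < ennreal e) sequentially"
          using e by (intro order_tendstoD(2)) auto
        then obtain n where "emeasure M (R n) < ennreal e"
          by (auto simp: eventually_sequentially)
        then show ?thesis
          by (intro exI[of _ "s ` {..n}"]) (auto simp: R_def s)
      qed
    qed
  qed
  ultimately have "U = compact_part E" by blast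
  then show ?thesis using that E by blast
qed

section \<open>The measure algebra as an order of ideals\<close>

definition class_ideal :: "'a set set \<Rightarrow> 'a set set" where
  "class_ideal P = (\<Union>A\<in>P. compact_part A)"

lemma class_ideal_class:
  assumes A: "A \<in> sets M"
  shows "class_ideal (measure_class M A) = compact_part A"
proof -
  have "compact_part B = compact_part A" if "B \<in> measure_class M A" for B
  proof -
    have "B \<in> sets M" "A - B \<in> null_sets M" "B - A \<in> null_sets M"
      using that by (auto simp: measure_class_def almost_equal_iff)
    then have "compact_part B \<subseteq> compact_part A" "compact_part A \<subseteq> compact_part B"
      using A by (simp_all add: compact_part_subset_iff)
    then show ?thesis by (rule antisym)
  qed
  then have "class_ideal (measure_class M A) = (\<Union>B\<in>measure_class M A. compact_part A)"
    unfolding class_ideal_def by (rule SUP_cong[OF refl])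
  then show ?thesis using measure_class_self[OF A] by auto
qed

lemma class_ideal_subset_iff:
  assumes "P \<in> carrier (measure_algebra M)" "Q \<in> carrier (measure_algebra M)"
  shows "class_ideal P \<subseteq> class_ideal Q \<longleftrightarrow> P \<sqsubseteq>\<^bsub>measure_algebra M\<^esub> Q"
proof -
  obtain A B where "A \<in> sets M" "P = measure_class M A" "B \<in> sets M" "Q = measure_class M B"
    using assms by (metis measure_algebraE)
  then show ?thesis
    by (simp add: class_ideal_class compact_part_subset_iff measure_class_le_iff)
qed

lemma compact_ideal_class_ideal:
  assumes "P \<in> carrier (measure_algebra M)"
  shows "compact_ideal (class_ideal P)"
proof -
  obtain A where "A \<in> sets M" "P = measure_class M A"
    using assms by (rule measure_algebraE)
  then show ?thesis by (simp add: class_ideal_class compact_ideal_compact_part)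
qed

lemma compact_ideal_eq_class_ideal:
  assumes "compact_ideal U"
  obtains P where "P \<in> carrier (measure_algebra M)" "U = class_ideal P"
proof -
  obtain E where "E \<in> sets M" "U = compact_part E"
    using compact_ideal_eq_compact_part[OF assms] .
  then show ?thesis
    using that[of "measure_class M E"] measure_class_carrier class_ideal_class by metis
qed

lemma inner_measure_class_ideal:
  assumes "P \<in> carrier (measure_algebra M)"
  shows "inner_measure (emeasure M) (class_ideal P) = measure_algebra_measure M P"
proof -
  obtain A where "A \<in> sets M" "P = measure_class M A"
    using assms by (rule measure_algebraE)
  then show ?thesis
    by (simp add: class_ideal_class inner_measure_compact_part measure_algebra_measure_class)
qed

lemma measure_algebra_measure_mono:
  assumes "P \<in> carrier (measure_algebra M)" "Q \<in> carrier (measure_algebra M)"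
    "P \<sqsubseteq>\<^bsub>measure_algebra M\<^esub> Q"
  shows "measure_algebra_measure M P \<le> measure_algebra_measure M Q"
proof -
  have "class_ideal P \<subseteq> class_ideal Q" using assms by (simp add: class_ideal_subset_iff)
  then have "inner_measure (emeasure M) (class_ideal P) \<le> inner_measure (emeasure M) (class_ideal Q)"
    unfolding inner_measure_def by (rule SUP_subset_mono) simp
  then show ?thesis using assms by (simp add: inner_measure_class_ideal)
qed

lemma compact_ideal_Inter:
  assumes "\<U> \<noteq> {}" and \<U>: "\<And>U. U \<in> \<U> \<Longrightarrow> compact_ideal U"
  shows "compact_ideal (\<Inter>\<U>)"
proof (rule compact_idealI)
  show "compactin X C" if "C \<in> \<Inter>\<U>" for C
    using that assms compact_ideal_compact by blast
  show "D \<in> \<Inter>\<U>" if "C \<in> \<Inter>\<U>" "compactin X D" "D \<subseteq> C" for C D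
    using that compact_ideal_subset[OF \<U>, of _ C D] by auto
  fix C S
  assume C: "compactin X C" "S \<subseteq> \<Inter>\<U>" "\<And>D. D \<in> S \<Longrightarrow> D \<subseteq> C"
    "\<And>e::real. e > 0 \<Longrightarrow> \<exists>T. finite T \<and> T \<subseteq> S \<and> emeasure M (C - \<Union>T) < ennreal e"
  show "C \<in> \<Inter>\<U>"
  proof
    fix U assume U: "U \<in> \<U>"
    show "C \<in> U"
      by (rule compact_ideal_cover[OF \<U>[OF U] C(1) _ C(3,4)]) (use C(2) U in auto)
  qed
qed

text \<open>
  Ideals are closed under intersection, and each of them comes from a class; so infima of classes
  are found as intersections of their ideals. This is the step in which uncountable families of
  measurable sets are handled.
\<close>
lemma complete_lattice_measure_algebra: "complete_lattice (measure_algebra M)"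
proof (rule partial_order.complete_lattice_criterion1[OF partial_order_measure_algebra])
  show "\<exists>T. greatest (measure_algebra M) T (carrier (measure_algebra M))"
    using measure_algebra_top by blast
  fix \<P> assume P: "\<P> \<subseteq> carrier (measure_algebra M)" "\<P> \<noteq> {}"
  have "compact_ideal (\<Inter>(class_ideal ` \<P>))"
    using P by (intro compact_ideal_Inter) (auto intro: compact_ideal_class_ideal)
  then obtain Q where Q: "Q \<in> carrier (measure_algebra M)"
    "\<Inter>(class_ideal ` \<P>) = class_ideal Q"
    by (rule compact_ideal_eq_class_ideal)
  have "greatest (measure_algebra M) Q (Lower (measure_algebra M) \<P>)"
  proof (rule greatest_LowerI)
    fix R assume "R \<in> \<P>"
    then have "class_ideal Q \<subseteq> class_ideal R" unfolding Q(2)[symmetric] by auto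
    then show "Q \<sqsubseteq>\<^bsub>measure_algebra M\<^esub> R"
      using P \<open>R \<in> \<P>\<close> Q(1) class_ideal_subset_iff by blast
  next
    fix R assume "R \<in> Lower (measure_algebra M) \<P>"
    then have R: "R \<in> carrier (measure_algebra M)" "\<And>S. S \<in> \<P> \<Longrightarrow> R \<sqsubseteq>\<^bsub>measure_algebra M\<^esub> S"
      using P by (auto simp: Lower_def)
    have "class_ideal R \<subseteq> class_ideal S" if "S \<in> \<P>" for S
      using that R P class_ideal_subset_iff[OF R(1)] by blast
    then have "class_ideal R \<subseteq> class_ideal Q" unfolding Q(2)[symmetric] by auto
    then show "R \<sqsubseteq>\<^bsub>measure_algebra M\<^esub> Q"
      using class_ideal_subset_iff[OF R(1) Q(1)] by blast
  qed (use P Q in auto)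
  then show "\<exists>Q. greatest (measure_algebra M) Q (Lower (measure_algebra M) \<P>)" ..
qed

section \<open>Continuity of the measure along directed suprema\<close>

lemma emeasure_less_add:
  assumes "A \<subseteq> B \<union> C" "B \<in> sets M" "C \<in> sets M"
    and "emeasure M B < ennreal b" "emeasure M C < ennreal c"
  shows "emeasure M A < ennreal (b + c)"
proof -
  have "emeasure M A \<le> emeasure M (B \<union> C)"
    using assms by (intro emeasure_mono) auto
  also have "\<dots> \<le> emeasure M B + emeasure M C"
    using assms by (intro emeasure_subadditive)
  also have "\<dots> < ennreal (b + c)" using assms(4,5) by (rule add_mono_ennreal)
  finally show ?thesis .
qed

text \<open>
  For the union \<open>W\<close> of a directed family of ideals, this is an explicit description of the join of
  the family. It shows that the measure of the join is approximated from \<open>W\<close>.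
\<close>
definition inner_approximable :: "'a set set \<Rightarrow> 'a set set" where
  "inner_approximable W = {C. compactin X C \<and>
    (\<forall>e::real. e > 0 \<longrightarrow> (\<exists>D\<in>W. D \<subseteq> C \<and> emeasure M (C - D) < ennreal e))}"

text \<open>
  Closure under inner covers is an \<open>e / 2\<close> argument in two stages: finitely many members leave out
  less than \<open>e / 2\<close> of \<open>C\<close>, and their union, which is again approximable, is approximated from \<open>W\<close>
  up to \<open>e / 2\<close>.
\<close>
lemma compact_ideal_inner_approximable:
  assumes compact: "\<And>C. C \<in> W \<Longrightarrow> compactin X C"
    and down: "\<And>C D. \<lbrakk>C \<in> W; compactin X D; D \<subseteq> C\<rbrakk> \<Longrightarrow> D \<in> W"
    and un: "\<And>C D. \<lbrakk>C \<in> W; D \<in> W\<rbrakk> \<Longrightarrow> C \<union> D \<in> W"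
    and ne: "W \<noteq> {}"
  shows "compact_ideal (inner_approximable W)"
proof (rule compact_idealI)
  have meas: "C - D \<in> sets M" if "compactin X C" "compactin X D" for C D
    using that compact_measurable compact_diff_measurable by blast
  have empty: "{} \<in> W" using ne down[of _ "{}"] by auto
  have Un: "C \<union> D \<in> inner_approximable W"
    if C: "C \<in> inner_approximable W" and D: "D \<in> inner_approximable W" for C D
  proof -
    have CD: "compactin X C" "compactin X D" using C D by (auto simp: inner_approximable_def)
    have "\<exists>B\<in>W. B \<subseteq> C \<union> D \<and> emeasure M (C \<union> D - B) < ennreal e" if "e > 0" for e :: real
    proof -
      have e: "e / 2 > 0" using that by simp
      obtain C' where C': "C' \<in> W" "C' \<subseteq> C" "emeasure M (C - C') < ennreal (e / 2)"
        using C e unfolding inner_approximable_def by blast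
      obtain D' where D': "D' \<in> W" "D' \<subseteq> D" "emeasure M (D - D') < ennreal (e / 2)"
        using D e unfolding inner_approximable_def by blast
      have "emeasure M (C \<union> D - (C' \<union> D')) < ennreal (e / 2 + e / 2)"
        by (rule emeasure_less_add[OF _ _ _ C'(3) D'(3)]) (use meas CD compact C' D' in auto)
      then show ?thesis using un[OF C'(1) D'(1)] C' D' by (intro bexI[of _ "C' \<union> D'"]) auto
    qed
    then show ?thesis using CD by (simp add: inner_approximable_def compactin_Un)
  qed
  fix C S
  assume C: "compactin X C" and S: "S \<subseteq> inner_approximable W" "\<And>D. D \<in> S \<Longrightarrow> D \<subseteq> C"
    and cover: "\<And>e::real. e > 0 \<Longrightarrow> \<exists>T. finite T \<and> T \<subseteq> S \<and> emeasure M (C - \<Union>T) < ennreal e"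
  have "\<exists>D\<in>W. D \<subseteq> C \<and> emeasure M (C - D) < ennreal e" if "e > 0" for e :: real
  proof -
    have e: "e / 2 > 0" using that by simp
    obtain T where T: "finite T" "T \<subseteq> S" "emeasure M (C - \<Union>T) < ennreal (e / 2)"
      using cover[OF e] by blast
    have "\<Union>T' \<in> inner_approximable W" if "T' \<subseteq> T" for T'
      using finite_subset[OF that T(1)] that
    proof (induction rule: finite_induct)
      case empty
      then show ?case using \<open>{} \<in> W\<close> by (auto simp: inner_approximable_def)
    next
      case (insert B T')
      then show ?case using Un[of B "\<Union>T'"] T S by auto
    qed
    then have UT: "\<Union>T \<in> inner_approximable W" by blast
    then obtain D where D: "D \<in> W" "D \<subseteq> \<Union>T" "emeasure M (\<Union>T - D) < ennreal (e / 2)"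
      using e unfolding inner_approximable_def by blast
    have "compactin X (\<Union>T)" using UT by (simp add: inner_approximable_def)
    then have "emeasure M (C - D) < ennreal (e / 2 + e / 2)"
      by (intro emeasure_less_add[OF _ _ _ T(3) D(3)]) (use meas C compact D in auto)
    moreover have "D \<subseteq> C" using D(2) T(2) S(2) by blast
    ultimately show ?thesis using D(1) by auto
  qed
  then show "C \<in> inner_approximable W" using C by (simp add: inner_approximable_def)
next
  fix C D
  assume C: "C \<in> inner_approximable W" and D: "compactin X D" "D \<subseteq> C"
  have "\<exists>B\<in>W. B \<subseteq> D \<and> emeasure M (D - B) < ennreal e" if "e > 0" for e :: real
  proof -
    obtain B where B: "B \<in> W" "B \<subseteq> C" "emeasure M (C - B) < ennreal e"
      using C \<open>e > 0\<close> unfolding inner_approximable_def by blast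
    have BD: "compactin X (B \<inter> D)" using compact[OF B(1)] D(1) by (rule compactin_Int)
    have "compactin X C" using C by (simp add: inner_approximable_def)
    then have "C - B \<in> sets M"
      using compact_measurable[OF compact[OF B(1)]] by (rule compact_diff_measurable)
    then have "emeasure M (D - B \<inter> D) \<le> emeasure M (C - B)"
      using D by (intro emeasure_mono) auto
    then show ?thesis
      using down[OF B(1) BD] B(3) by (intro bexI[of _ "B \<inter> D"]) auto
  qed
  then show "D \<in> inner_approximable W" using D by (simp add: inner_approximable_def)
qed (simp add: inner_approximable_def)

lemma inner_measure_inner_approximable_le:
  assumes "\<And>C. C \<in> W \<Longrightarrow> compactin X C" "\<And>C. C \<in> W \<Longrightarrow> emeasure M C \<le> a"
  shows "inner_measure (emeasure M) (inner_approximable W) \<le> a"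
  unfolding inner_measure_def
proof (rule SUP_least)
  fix C assume C: "C \<in> inner_approximable W"
  have approx: "emeasure M C \<le> a + ennreal e" if "e > 0" for e :: real
  proof -
    obtain D where D: "D \<in> W" "D \<subseteq> C" "emeasure M (C - D) < ennreal e"
      using C \<open>e > 0\<close> unfolding inner_approximable_def by blast
    have meas: "C \<in> sets M" "D \<in> sets M"
      using C D assms(1) compact_measurable by (auto simp: inner_approximable_def)
    have "emeasure M C = emeasure M (D \<union> (C - D))" using D(2) by (simp add: Un_absorb1)
    also have "\<dots> \<le> emeasure M D + emeasure M (C - D)"
      using meas by (intro emeasure_subadditive) auto
    also have "\<dots> \<le> a + ennreal e"
      using assms(2)[OF D(1)] D(3) by (intro add_mono) auto
    finally show ?thesis .
  qed
  show "emeasure M C \<le> a" by (rule ennreal_le_epsilon) (rule approx)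
qed

text \<open>
  Let \<open>W\<close> be the union of the ideals of the family; directedness makes it closed under
  binary unions. The ideal \<^term>\<open>inner_approximable W\<close> is that of a class \<open>Q\<close>, an upper bound of
  the family, and the measure of \<open>Q\<close> is at most the supremum of the measures.
\<close>
lemma measure_algebra_measure_directed_Sup:
  assumes "directed_subset (measure_algebra M) \<P>"
  shows "measure_algebra_measure M (\<Squnion>\<^bsub>measure_algebra M\<^esub>\<P>) = (SUP P\<in>\<P>. measure_algebra_measure M P)"
proof -
  interpret complete_lattice "measure_algebra M" by (rule complete_lattice_measure_algebra)
  have P: "\<P> \<subseteq> carrier (measure_algebra M)" "\<P> \<noteq> {}"
    and directed: "\<And>P Q. \<lbrakk>P \<in> \<P>; Q \<in> \<P>\<rbrakk> \<Longrightarrow>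
      \<exists>R\<in>\<P>. P \<sqsubseteq>\<^bsub>measure_algebra M\<^esub> R \<and> Q \<sqsubseteq>\<^bsub>measure_algebra M\<^esub> R"
    using assms by (auto simp: directed_subset_def)
  have ideal: "compact_ideal (class_ideal P)" if "P \<in> \<P>" for P
    using that P compact_ideal_class_ideal by blast
  define W where "W = \<Union>(class_ideal ` \<P>)"
  have W: "compactin X C" if "C \<in> W" for C
    using that ideal compact_ideal_compact by (auto simp: W_def)
  have "compact_ideal (inner_approximable W)"
  proof (rule compact_ideal_inner_approximable[OF W])
    show "D \<in> W" if "C \<in> W" "compactin X D" "D \<subseteq> C" for C D
    proof -
      obtain P where P: "P \<in> \<P>" "C \<in> class_ideal P" using \<open>C \<in> W\<close> by (auto simp: W_def)
      then have "D \<in> class_ideal P"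
        using compact_ideal_subset[OF ideal[OF P(1)] P(2)] that by simp
      then show ?thesis using P(1) by (auto simp: W_def)
    qed
    show "C \<union> D \<in> W" if CD: "C \<in> W" "D \<in> W" for C D
    proof -
      obtain P Q where PQ: "P \<in> \<P>" "C \<in> class_ideal P" "Q \<in> \<P>" "D \<in> class_ideal Q"
        using CD by (auto simp: W_def)
      then obtain R where R: "R \<in> \<P>" "P \<sqsubseteq>\<^bsub>measure_algebra M\<^esub> R" "Q \<sqsubseteq>\<^bsub>measure_algebra M\<^esub> R"
        using directed by blast
      then have "class_ideal P \<subseteq> class_ideal R" "class_ideal Q \<subseteq> class_ideal R"
        using PQ P by (auto simp: class_ideal_subset_iff subset_iff[of \<P>])
      then have CDR: "C \<in> class_ideal R" "D \<in> class_ideal R" using PQ by auto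
      obtain E where "E \<in> sets M" "R = measure_class M E"
        using R(1) P(1) measure_algebraE by blast
      then have "C \<union> D \<in> class_ideal R"
        using CDR by (auto simp: class_ideal_class compact_part_def compactin_Un Un_Diff)
      then show ?thesis using R(1) by (auto simp: W_def)
    qed
    obtain P where "P \<in> \<P>" using P(2) by auto
    moreover obtain E where "E \<in> sets M" "P = measure_class M E"
      using \<open>P \<in> \<P>\<close> P(1) measure_algebraE by blast
    ultimately have "{} \<in> W"
      by (auto simp: W_def class_ideal_class compact_part_def intro!: bexI[of _ P])
    then show "W \<noteq> {}" by auto
  qed
  then obtain Q where Q: "Q \<in> carrier (measure_algebra M)" "inner_approximable W = class_ideal Q"
    by (rule compact_ideal_eq_class_ideal)
  have WV: "W \<subseteq> inner_approximable W"
  proof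
    fix C assume "C \<in> W"
    then show "C \<in> inner_approximable W"
      using W by (auto simp: inner_approximable_def intro!: bexI[of _ C])
  qed
  have "P \<sqsubseteq>\<^bsub>measure_algebra M\<^esub> Q" if "P \<in> \<P>" for P
  proof -
    have "class_ideal P \<subseteq> W" using that by (auto simp: W_def)
    then have "class_ideal P \<subseteq> class_ideal Q" using WV Q(2) by simp
    then show ?thesis using class_ideal_subset_iff[OF subsetD[OF P(1) that] Q(1)] by simp
  qed
  then have "\<Squnion>\<^bsub>measure_algebra M\<^esub>\<P> \<sqsubseteq>\<^bsub>measure_algebra M\<^esub> Q"
    using P Q by (intro sup_least) auto
  then have "measure_algebra_measure M (\<Squnion>\<^bsub>measure_algebra M\<^esub>\<P>) \<le> measure_algebra_measure M Q"
    using P Q by (intro measure_algebra_measure_mono) auto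
  also have "\<dots> = inner_measure (emeasure M) (inner_approximable W)"
    using Q by (simp add: inner_measure_class_ideal)
  also have "\<dots> \<le> (SUP P\<in>\<P>. measure_algebra_measure M P)"
  proof (rule inner_measure_inner_approximable_le[OF W])
    fix C assume "C \<in> W"
    then obtain P where "P \<in> \<P>" "C \<in> class_ideal P" by (auto simp: W_def)
    have "emeasure M C \<le> inner_measure (emeasure M) (class_ideal P)"
      unfolding inner_measure_def using \<open>C \<in> class_ideal P\<close> by (rule SUP_upper)
    also have "\<dots> = measure_algebra_measure M P"
      using P(1) \<open>P \<in> \<P>\<close> by (intro inner_measure_class_ideal) auto
    also have "\<dots> \<le> (SUP P\<in>\<P>. measure_algebra_measure M P)"
      using \<open>P \<in> \<P>\<close> by (rule SUP_upper)
    finally show "emeasure M C \<le> (SUP P\<in>\<P>. measure_algebra_measure M P)" .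
  qed
  finally have "measure_algebra_measure M (\<Squnion>\<^bsub>measure_algebra M\<^esub>\<P>) \<le>
    (SUP P\<in>\<P>. measure_algebra_measure M P)" .
  moreover have "(SUP P\<in>\<P>. measure_algebra_measure M P) \<le>
    measure_algebra_measure M (\<Squnion>\<^bsub>measure_algebra M\<^esub>\<P>)"
    using P by (intro SUP_least measure_algebra_measure_mono) (auto intro: sup_upper)
  ultimately show ?thesis by (rule antisym)
qed

section \<open>The isomorphism of locales\<close>

lemma complete_boolean_algebra_measure_algebra: "complete_boolean_algebra (measure_algebra M)"
  by (intro complete_measure_algebra.complete_boolean_algebra complete_measure_algebra.intro
      complete_lattice_measure_algebra)

lemma measured_frame_measure_algebra:
  "measured_frame (measure_algebra M) (measure_algebra_measure M)"
proof -
  interpret complete_measure_algebra M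
    by (intro complete_measure_algebra.intro complete_lattice_measure_algebra)
  interpret frame "measure_algebra M"
    by (rule complete_boolean_algebra.frame[OF complete_boolean_algebra])
  show ?thesis
  proof unfold_locales
    fix P Q assume "P \<in> carrier (measure_algebra M)" "Q \<in> carrier (measure_algebra M)"
    then obtain A B where "A \<in> sets M" "P = measure_class M A" "B \<in> sets M" "Q = measure_class M B"
      by (metis measure_algebraE)
    then show "measure_algebra_measure M P + measure_algebra_measure M Q =
      measure_algebra_measure M (P \<squnion>\<^bsub>measure_algebra M\<^esub> Q) +
      measure_algebra_measure M (P \<sqinter>\<^bsub>measure_algebra M\<^esub> Q)"
      using emeasure_Un_Int[of A M B]
      by (simp add: join_class meet_class measure_algebra_measure_class)
  next
    show "measure_algebra_measure M \<bottom>\<^bsub>measure_algebra M\<^esub> = 0"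
      by (simp add: bottom_class measure_algebra_measure_class)
  qed (simp_all add: measure_algebra_measure_mono measure_algebra_measure_directed_Sup)
qed

lemma class_ideal_isomorphism:
  "complete_lattice_isomorphism (measure_algebra M)
    (valuation_locale (compact_lattice X) (emeasure M)) class_ideal"
proof -
  interpret source: complete_lattice "measure_algebra M"
    by (rule complete_lattice_measure_algebra)
  interpret target: partial_order "valuation_locale (compact_lattice X) (emeasure M)"
    by unfold_locales (auto simp: valuation_locale_def)
  have carrier: "carrier (valuation_locale (compact_lattice X) (emeasure M)) = {U. compact_ideal U}"
    by (simp add: valuation_locale_def compact_ideal_def)
  show ?thesis
  proof unfold_locales
    have "inj_on class_ideal (carrier (measure_algebra M))"
    proof (rule inj_onI)
      fix P Q assume PQ: "P \<in> carrier (measure_algebra M)" "Q \<in> carrier (measure_algebra M)"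
        and "class_ideal P = class_ideal Q"
      then have "P \<sqsubseteq>\<^bsub>measure_algebra M\<^esub> Q" "Q \<sqsubseteq>\<^bsub>measure_algebra M\<^esub> P"
        by (simp_all flip: class_ideal_subset_iff)
      then show "P = Q" using PQ by (rule source.le_antisym)
    qed
    moreover have "class_ideal ` carrier (measure_algebra M) = {U. compact_ideal U}"
      using compact_ideal_class_ideal compact_ideal_eq_class_ideal by blast
    ultimately show "bij_betw class_ideal (carrier (measure_algebra M))
        (carrier (valuation_locale (compact_lattice X) (emeasure M)))"
      by (simp add: bij_betw_def carrier)
  qed (simp add: valuation_locale_def class_ideal_subset_iff)
qed

end

theorem theorem1p2:
  fixes X :: "'a topology" and M :: "'a measure"
  assumes "radon_measure X M"
  shows "complete_boolean_algebra (measure_algebra M) \<and>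
    measure_preserving_locale_iso
      (valuation_locale (compact_lattice X) (emeasure M)) (inner_measure (emeasure M))
      (measure_algebra M) (measure_algebra_measure M)"
proof
  interpret radon_measure X M by fact
  interpret complete_lattice_isomorphism "measure_algebra M"
    "valuation_locale (compact_lattice X) (emeasure M)" class_ideal
    by (rule class_ideal_isomorphism)
  show "complete_boolean_algebra (measure_algebra M)"
    by (rule complete_boolean_algebra_measure_algebra)
  show "measure_preserving_locale_iso
      (valuation_locale (compact_lattice X) (emeasure M)) (inner_measure (emeasure M))
      (measure_algebra M) (measure_algebra_measure M)"
    by (rule measure_preserving_locale_iso[OF measured_frame_measure_algebra
          inner_measure_class_ideal])
qed

end
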